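(* The following problem is decidable: given a semilinear equivariant nondeterministic finite automaton with the integer atoms, decide whether the language it accepts is empty.
   Context: Integer atoms: the atoms are the integers $\mathbb{Z}$ with the successor function; the automorphisms are exactly the translations $x\mapsto x+z$, acting hereditarily on sets built from atoms. A set, relation or function is equivariant if invariant under all translations; an equivariant set is orbit-finite if it is a finite union of orbits. For $k\ge1$, $\mathbb{Z}_k$ is the integers modulo $k$ with translations acting by addition, $\mathbb{Z}_0=\mathbb{Z}$; every equivariant single-orbit set is equivariantly isomorphic to some $\mathbb{Z}_k$. A monomial set is a finite product of equivariant single-orbit sets, a polynomial set a finite disjoint union of monomials. A subset of $\mathbb{Z}^m$ is semilinear if Presburger-definable; every subset of $\mathbb{Z}_k$ ($k\ge1$) is semilinear; subsets of general monomials and polynomial sets are semilinear if they are semilinear after transport along equivariant isomorphisms to disjoint unions of monomials $\mathbb{Z}^m$, $\mathbb{Z}_k$ (via $\mathbb{Z}_k\times\mathbb{Z}\cong k$ copies of $\mathbb{Z}$, $\mathbb{Z}_k\times\mathbb{Z}_l\cong\mathbb{Z}_{\mathrm{lcm}(k,l)}$), componentwise. An NFA with atoms consists of an orbit-finite equivariant alphabet $A$, an orbit-finite equivariant state set $Q$, a transition relation $\delta\subseteq Q\times A\times Q$, and initial and accepting sets $I,F\subseteq Q$. It is equivariant if $\delta,I,F$ are equivariant, and semilinear if $\delta$ is a semilinear subset of the polynomial set $Q\times A\times Q$. The input is given by the characteristics of the orbits and Presburger descriptions of $\delta$ on each monomial. *)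

theory Defs
  imports "HOL-Library.Nat_Bijection" "HOL-Algebra.Group_Action" "HOL-Algebra.Elementary_Groups"
begin

section \<open>Presburger formulas\<close>

text \<open>
  First-order formulas over the integers with addition and order. Variables are de Bruijn
  indices: \<^term>\<open>Var 0\<close> in the body of a quantifier is the variable it binds. The scalar
  multiples abbreviate iterated sums.
\<close>

datatype pterm = Num int | Var nat | Add pterm pterm | Scale int pterm

datatype pform = Eq pterm pterm | Leq pterm pterm | Neg pform | Conj pform pform | Ex pform

primrec tval :: "(nat \<Rightarrow> int) \<Rightarrow> pterm \<Rightarrow> int" where
  "tval e (Num c) = c"
| "tval e (Var n) = e n"
| "tval e (Add s t) = tval e s + tval e t"
| "tval e (Scale c t) = c * tval e t"

primrec sat :: "pform \<Rightarrow> (nat \<Rightarrow> int) \<Rightarrow> bool" where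
  "sat (Eq s t) e \<longleftrightarrow> tval e s = tval e t"
| "sat (Leq s t) e \<longleftrightarrow> tval e s \<le> tval e t"
| "sat (Neg p) e \<longleftrightarrow> \<not> sat p e"
| "sat (Conj p q) e \<longleftrightarrow> sat p e \<and> sat q e"
| "sat (Ex p) e \<longleftrightarrow> (\<exists>x. sat p (case_nat x e))"

text \<open>Free variables beyond the length of the tuple are read as \<open>0\<close>.\<close>

definition valuation :: "int list \<Rightarrow> nat \<Rightarrow> int" where
  "valuation xs n = (if n < length xs then xs ! n else 0)"

text \<open>Vectors of dimension \<open>m\<close> are the lists of length \<open>m\<close>.\<close>

definition semilinear :: "nat \<Rightarrow> int list set \<Rightarrow> bool" where
  "semilinear m S \<longleftrightarrow> (\<exists>p. S = {xs. length xs = m \<and> sat p (valuation xs)})"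


section \<open>Sets with integer atoms\<close>

text \<open>
  An equivariant set is a set with an action of the translation group; it is orbit-finite if
  the action has finitely many orbits.
\<close>

definition orbit_finite_set :: "'x set \<Rightarrow> (int \<Rightarrow> 'x \<Rightarrow> 'x) \<Rightarrow> bool" where
  "orbit_finite_set X act \<longleftrightarrow>
     group_action integer_group X act \<and> finite (orbits integer_group X act)"

definition equivariant_subset :: "(int \<Rightarrow> 'x \<Rightarrow> 'x) \<Rightarrow> 'x set \<Rightarrow> bool" where
  "equivariant_subset act S \<longleftrightarrow> (\<forall>z. act z ` S = S)"

text \<open>
  The integers modulo \<open>k\<close>, represented by the numbers \<open>0, \<dots>, k - 1\<close>. As \<open>x mod 0 = x\<close>,
  the case \<open>k = 0\<close> gives all integers.
\<close>

definition Zmod :: "nat \<Rightarrow> int set" where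
  "Zmod k = {x. x mod int k = x}"

text \<open>The disjoint union of \<^term>\<open>Zmod (ks ! i)\<close> for \<open>i < length ks\<close>, and its translations.\<close>

definition orbit_sum :: "nat list \<Rightarrow> (nat \<times> int) set" where
  "orbit_sum ks = {(i, x). i < length ks \<and> x \<in> Zmod (ks ! i)}"

definition shift :: "nat list \<Rightarrow> int \<Rightarrow> nat \<times> int \<Rightarrow> nat \<times> int" where
  "shift ks z = (\<lambda>(i, x) \<in> orbit_sum ks. (i, (x + z) mod int (ks ! i)))"

definition chart ::
    "'x set \<Rightarrow> (int \<Rightarrow> 'x \<Rightarrow> 'x) \<Rightarrow> nat list \<Rightarrow> ('x \<Rightarrow> nat \<times> int) \<Rightarrow> bool" where
  "chart X act ks f \<longleftrightarrow>
     bij_betw f X (orbit_sum ks) \<and> (\<forall>x\<in>X. \<forall>z. f (act z x) = shift ks z (f x))"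

text \<open>
  Let \<open>ks = [k\<^sub>1, \<dots>, k\<^sub>n]\<close> and let \<open>m\<close> be the number of zeros in \<open>ks\<close>. If \<open>m > 0\<close>, the
  isomorphism that sends \<open>(a, x)\<close> in \<open>Zmod k \<times> Zmod 0\<close> to \<open>x\<close> in the copy of \<open>Zmod 0\<close> with
  index \<open>(a - x) mod k\<close> turns the monomial \<open>Zmod k\<^sub>1 \<times> \<dots> \<times> Zmod k\<^sub>n\<close> into finitely many
  copies of the \<open>m\<close>-th power of the integers: \<open>offsets\<close> is the index of the copy, and
  \<open>free_coords\<close> the vector in it. Which of the infinite factors is used to compute the index
  does not matter for semilinearity; we take the first. If \<open>m = 0\<close>, the monomial is a finite
  union of finite orbits, and all its subsets are semilinear.
\<close>

definition free_coords :: "nat list \<Rightarrow> int list \<Rightarrow> int list" where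
  "free_coords ks xs = [x. (k, x) \<leftarrow> zip ks xs, k = 0]"

definition offsets :: "nat list \<Rightarrow> int list \<Rightarrow> int list" where
  "offsets ks xs = [(x - hd (free_coords ks xs)) mod int k. (k, x) \<leftarrow> zip ks xs, k \<noteq> 0]"

definition semilinear_monomial :: "nat list \<Rightarrow> int list set \<Rightarrow> bool" where
  "semilinear_monomial ks S \<longleftrightarrow>
     (0 \<in> set ks \<longrightarrow>
       (\<forall>c. semilinear (count_list ks 0) (free_coords ks ` {xs \<in> S. offsets ks xs = c})))"


section \<open>Automata\<close>

record ('q, 'a) nfa =
  states :: "'q set"
  state_act :: "int \<Rightarrow> 'q \<Rightarrow> 'q"
  letters :: "'a set"
  letter_act :: "int \<Rightarrow> 'a \<Rightarrow> 'a"
  transitions :: "('q \<times> 'a \<times> 'q) set"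
  initial :: "'q set"
  accepting :: "'q set"

definition nfa_with_atoms :: "('q, 'a) nfa \<Rightarrow> bool" where
  "nfa_with_atoms M \<longleftrightarrow>
     orbit_finite_set (letters M) (letter_act M) \<and>
     orbit_finite_set (states M) (state_act M) \<and>
     transitions M \<subseteq> states M \<times> letters M \<times> states M \<and>
     initial M \<subseteq> states M \<and> accepting M \<subseteq> states M"

definition trans_act :: "('q, 'a) nfa \<Rightarrow> int \<Rightarrow> 'q \<times> 'a \<times> 'q \<Rightarrow> 'q \<times> 'a \<times> 'q" where
  "trans_act M z = (\<lambda>(q, a, q'). (state_act M z q, letter_act M z a, state_act M z q'))"

definition equivariant_nfa :: "('q, 'a) nfa \<Rightarrow> bool" where
  "equivariant_nfa M \<longleftrightarrow>
     equivariant_subset (trans_act M) (transitions M) \<and>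
     equivariant_subset (state_act M) (initial M) \<and>
     equivariant_subset (state_act M) (accepting M)"

text \<open>
  Two charts of the same set differ by a permutation of the orbits and a translation on each
  orbit, so the choice of the charts does not matter.
\<close>

definition semilinear_nfa :: "('q, 'a) nfa \<Rightarrow> bool" where
  "semilinear_nfa M \<longleftrightarrow> (\<exists>ks f ls g.
     chart (states M) (state_act M) ks f \<and> chart (letters M) (letter_act M) ls g \<and>
     (\<forall>i<length ks. \<forall>a<length ls. \<forall>j<length ks.
        semilinear_monomial [ks ! i, ls ! a, ks ! j]
          {[x, y, z] | x y z. \<exists>(q, l, q') \<in> transitions M.
             f q = (i, x) \<and> g l = (a, y) \<and> f q' = (j, z)}))"

inductive run :: "('q, 'a) nfa \<Rightarrow> 'q \<Rightarrow> 'a list \<Rightarrow> 'q \<Rightarrow> bool" for M where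
  "run M q [] q"
| "(q, a, q') \<in> transitions M \<Longrightarrow> run M q' w q'' \<Longrightarrow> run M q (a # w) q''"

definition language :: "('q, 'a) nfa \<Rightarrow> 'a list set" where
  "language M = {w \<in> lists (letters M). \<exists>q \<in> initial M. \<exists>q' \<in> accepting M. run M q w q'}"


section \<open>Finite descriptions of automata\<close>

text \<open>
  The orbits of states and of letters are given by their characteristics, and are referred to
  by their positions in these lists. An equivariant set of states is a union of orbits. An
  entry \<open>(i, a, j, p)\<close> of \<open>trans_forms\<close> describes the transitions from orbit \<open>i\<close> to orbit
  \<open>j\<close> with letters in orbit \<open>a\<close>; the elements of \<^term>\<open>Zmod k\<close> enter the formula \<open>p\<close> as the
  integers that represent them. A monomial without an entry has no transitions, and several
  entries for the same monomial denote the union.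
\<close>

record description =
  state_chars :: "nat list"
  letter_chars :: "nat list"
  init_orbits :: "nat list"
  acc_orbits :: "nat list"
  trans_forms :: "(nat \<times> nat \<times> nat \<times> pform) list"

definition nfa_of :: "description \<Rightarrow> (nat \<times> int, nat \<times> int) nfa" where
  "nfa_of D =
     \<lparr>states = orbit_sum (state_chars D),
      state_act = shift (state_chars D),
      letters = orbit_sum (letter_chars D),
      letter_act = shift (letter_chars D),
      transitions = {((i, x), (a, y), (j, z)).
        (i, x) \<in> orbit_sum (state_chars D) \<and> (a, y) \<in> orbit_sum (letter_chars D) \<and>
        (j, z) \<in> orbit_sum (state_chars D) \<and>
        (\<exists>p. (i, a, j, p) \<in> set (trans_forms D) \<and> sat p (valuation [x, y, z]))},
      initial = {(i, x) \<in> orbit_sum (state_chars D). i \<in> set (init_orbits D)},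
      accepting = {(i, x) \<in> orbit_sum (state_chars D). i \<in> set (acc_orbits D)}\<rparr>"

primrec code_pterm :: "pterm \<Rightarrow> nat" where
  "code_pterm (Num c) = prod_encode (0, int_encode c)"
| "code_pterm (Var n) = prod_encode (1, n)"
| "code_pterm (Add s t) = prod_encode (2, prod_encode (code_pterm s, code_pterm t))"
| "code_pterm (Scale c t) = prod_encode (3, prod_encode (int_encode c, code_pterm t))"

primrec code_pform :: "pform \<Rightarrow> nat" where
  "code_pform (Eq s t) = prod_encode (0, prod_encode (code_pterm s, code_pterm t))"
| "code_pform (Leq s t) = prod_encode (1, prod_encode (code_pterm s, code_pterm t))"
| "code_pform (Neg p) = prod_encode (2, code_pform p)"
| "code_pform (Conj p q) = prod_encode (3, prod_encode (code_pform p, code_pform q))"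
| "code_pform (Ex p) = prod_encode (4, code_pform p)"

definition code_entry :: "nat \<times> nat \<times> nat \<times> pform \<Rightarrow> nat" where
  "code_entry = (\<lambda>(i, a, j, p). list_encode [i, a, j, code_pform p])"

definition code_description :: "description \<Rightarrow> nat" where
  "code_description D = list_encode
     [list_encode (state_chars D), list_encode (letter_chars D),
      list_encode (init_orbits D), list_encode (acc_orbits D),
      list_encode (map code_entry (trans_forms D))]"


lemma code_pterm_inject: "code_pterm s = code_pterm t \<longleftrightarrow> s = t"
  by (induction s arbitrary: t; case_tac t; auto simp: int_encode_eq)

lemma code_pform_inject: "code_pform p = code_pform q \<longleftrightarrow> p = q"
  by (induction p arbitrary: q; case_tac q; auto simp: code_pterm_inject)

lemma inj_code_description: "inj code_description"
proof -
  have entry: "inj code_entry"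
    by (rule injI) (auto simp: code_entry_def code_pform_inject list_encode_eq simp del: list_encode.simps)
  show ?thesis
  proof (rule injI)
    fix D E :: description
    assume "code_description D = code_description E"
    then show "D = E"
      by (auto simp: code_description_def inj_map_eq_map[OF entry] list_encode_eq simp del: list_encode.simps
          intro!: description.equality)
  qed
qed


section \<open>Decidability\<close>

text \<open>Programs for the partial recursive functions, with Kleene's operators.\<close>

datatype recf =
  Zero
| Succ
| Proj nat
| Comp recf "recf list"
| PrimRec recf recf
| Mu recf

inductive computes :: "recf \<Rightarrow> nat list \<Rightarrow> nat \<Rightarrow> bool" where
  "computes Zero xs 0"
| "computes Succ [x] (Suc x)"
| "i < length xs \<Longrightarrow> computes (Proj i) xs (xs ! i)"
| "list_all2 (\<lambda>g y. computes g xs y) gs ys \<Longrightarrow> computes f ys z \<Longrightarrow> computes (Comp f gs) xs z"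
| "computes f xs y \<Longrightarrow> computes (PrimRec f g) (0 # xs) y"
| "computes (PrimRec f g) (n # xs) y \<Longrightarrow> computes g (n # y # xs) z \<Longrightarrow>
     computes (PrimRec f g) (Suc n # xs) z"
| "computes f (n # xs) 0 \<Longrightarrow> (\<And>m. m < n \<Longrightarrow> \<exists>y. computes f (m # xs) (Suc y)) \<Longrightarrow>
     computes (Mu f) xs n"

inductive_cases computes_elims:
  "computes Zero xs y" "computes Succ xs y" "computes (Proj i) xs y"
  "computes (Comp f gs) xs y" "computes (PrimRec f g) (0 # xs) y"
  "computes (PrimRec f g) (Suc n # xs) y" "computes (Mu f) xs y"

lemma computes_det: "computes f xs y \<Longrightarrow> computes f xs y' \<Longrightarrow> y = y'"
proof (induction arbitrary: y' rule: computes.induct)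
  case (4 xs gs ys f z)
  from "4.prems" obtain ys' where ys': "list_all2 (\<lambda>g y. computes g xs y) gs ys'"
    and z: "computes f ys' y'" by (rule computes_elims(4))
  have "ys = ys'"
    using "4.IH"(1) ys' by (auto simp: list_all2_conv_all_nth intro!: nth_equalityI)
  with z "4.IH"(2) show ?case by blast
next
  case (5 f xs y g)
  from "5.prems" have "computes f xs y'" by (rule computes_elims(5))
  with "5.IH" show ?case by blast
next
  case (6 f g n xs y z)
  from "6.prems" obtain y1 where "computes (PrimRec f g) (n # xs) y1" "computes g (n # y1 # xs) y'"
    by (rule computes_elims(6))
  with "6.IH" show ?case by blast
next
  case (7 f n xs)
  from "7.prems" have 0: "computes f (y' # xs) 0"
    and pos: "\<And>m. m < y' \<Longrightarrow> \<exists>y. computes f (m # xs) (Suc y)"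
    by (rule computes_elims(7), blast)+
  show ?case
  proof (rule linorder_cases[of n y'])
    assume "n < y'" with pos "7.IH"(1) show ?thesis by blast
  next
    assume "y' < n" with 0 "7.IH"(2) show ?thesis by blast
  qed simp
qed (blast elim: computes_elims(1-3))+

text \<open>
  The problem \<open>Q\<close>, for inputs from \<open>X\<close> that are coded by \<open>code\<close>, is decidable: one program
  halts with the right answer on all these inputs.
\<close>

definition decidable :: "('i \<Rightarrow> nat) \<Rightarrow> 'i set \<Rightarrow> ('i \<Rightarrow> bool) \<Rightarrow> bool" where
  "decidable code X Q \<longleftrightarrow> (\<exists>f. \<forall>i\<in>X. computes f [code i] (if Q i then 1 else 0))"


section \<open>Adequacy of the descriptions\<close>

text \<open>
  Every description denotes a semilinear automaton with atoms; equivariance of its transition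
  relation is a condition on the formulas. Conversely, every semilinear equivariant automaton,
  over arbitrary sets with atoms, is isomorphic to one that has a description.
\<close>

lemma shift_closed: "q \<in> orbit_sum ks \<Longrightarrow> shift ks z q \<in> orbit_sum ks"
  by (auto simp: shift_def orbit_sum_def Zmod_def)

lemma shift_add: "q \<in> orbit_sum ks \<Longrightarrow> shift ks y (shift ks z q) = shift ks (y + z) q"
  using shift_closed[of q ks z]
  by (auto simp: shift_def mod_simps algebra_simps split: prod.splits)

lemma shift_zero: "q \<in> orbit_sum ks \<Longrightarrow> shift ks 0 q = q"
  by (auto simp: shift_def orbit_sum_def Zmod_def)

lemma orbit_finite_orbit_sum: "orbit_finite_set (orbit_sum ks) (shift ks)"
proof -
  have bij: "shift ks z \<in> Bij (orbit_sum ks)" for z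
  proof -
    have "bij_betw (shift ks z) (orbit_sum ks) (orbit_sum ks)"
      by (rule bij_betw_byWitness[where f' = "shift ks (- z)"])
        (auto simp: shift_add shift_zero shift_closed)
    then show ?thesis by (simp add: Bij_def shift_def)
  qed
  have "shift ks (y + z) = compose (orbit_sum ks) (shift ks y) (shift ks z)" for y z
    by (rule ext) (simp add: compose_def shift_add, simp add: shift_def)
  then have "group_action integer_group (orbit_sum ks) (shift ks)"
    using bij unfolding group_action_def group_hom_def group_hom_axioms_def
    by (auto simp: hom_def BijGroup_def group_BijGroup[unfolded BijGroup_def])
  moreover have "orbits integer_group (orbit_sum ks) (shift ks)
      \<subseteq> (\<lambda>i. {i} \<times> Zmod (ks ! i)) ` {..<length ks}"
  proof
    fix O' assume "O' \<in> orbits integer_group (orbit_sum ks) (shift ks)"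
    then obtain i x where x: "(i, x) \<in> orbit_sum ks" and O': "O' = {shift ks z (i, x) | z. True}"
      by (auto simp: orbits_def orbit_def)
    have "(i, y) \<in> O'" if "y \<in> Zmod (ks ! i)" for y
    proof -
      have "(i, y) = shift ks (y - x) (i, x)" using x that by (simp add: shift_def Zmod_def)
      then show ?thesis unfolding O' by blast
    qed
    then have "O' = {i} \<times> Zmod (ks ! i)"
      using x unfolding O' by (auto simp: shift_def Zmod_def)
    then show "O' \<in> (\<lambda>i. {i} \<times> Zmod (ks ! i)) ` {..<length ks}"
      using x by (auto simp: orbit_sum_def)
  qed
  then have "finite (orbits integer_group (orbit_sum ks) (shift ks))"
    by (rule finite_subset) simp
  ultimately show ?thesis by (simp add: orbit_finite_set_def)
qed

lemma nfa_with_atoms_nfa_of: "nfa_with_atoms (nfa_of D)"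
  by (auto simp: nfa_with_atoms_def nfa_of_def orbit_finite_orbit_sum)

text \<open>Relations on valuations that are defined by a Presburger formula, and linear terms:\<close>

definition definable :: "((nat \<Rightarrow> int) \<Rightarrow> bool) \<Rightarrow> bool" where
  "definable R \<longleftrightarrow> (\<exists>p. \<forall>e. sat p e \<longleftrightarrow> R e)"

definition linear :: "((nat \<Rightarrow> int) \<Rightarrow> int) \<Rightarrow> bool" where
  "linear f \<longleftrightarrow> (\<exists>t. \<forall>e. tval e t = f e)"

primrec subst_pterm :: "(nat \<Rightarrow> pterm) \<Rightarrow> pterm \<Rightarrow> pterm" where
  "subst_pterm r (Num c) = Num c"
| "subst_pterm r (Var n) = r n"
| "subst_pterm r (Add s t) = Add (subst_pterm r s) (subst_pterm r t)"
| "subst_pterm r (Scale c t) = Scale c (subst_pterm r t)"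

lemma tval_subst: "tval e (subst_pterm r t) = tval (\<lambda>n. tval e (r n)) t"
  by (induction t) auto

primrec subst_pform :: "(nat \<Rightarrow> pterm) \<Rightarrow> pform \<Rightarrow> pform" where
  "subst_pform r (Eq s t) = Eq (subst_pterm r s) (subst_pterm r t)"
| "subst_pform r (Leq s t) = Leq (subst_pterm r s) (subst_pterm r t)"
| "subst_pform r (Neg p) = Neg (subst_pform r p)"
| "subst_pform r (Conj p q) = Conj (subst_pform r p) (subst_pform r q)"
| "subst_pform r (Ex p) =
     Ex (subst_pform (case_nat (Var 0) (\<lambda>n. subst_pterm (\<lambda>n. Var (Suc n)) (r n))) p)"

lemma sat_subst: "sat (subst_pform r p) e \<longleftrightarrow> sat p (\<lambda>n. tval e (r n))"
proof (induction p arbitrary: r e)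
  case (Ex p)
  have "(\<lambda>n. tval (case_nat x e) (case_nat (Var 0) (\<lambda>n. subst_pterm (\<lambda>n. Var (Suc n)) (r n)) n))
      = case_nat x (\<lambda>n. tval e (r n))" for x
    by (rule ext) (simp add: tval_subst split: nat.split)
  then show ?case by (simp add: Ex)
qed (simp_all add: tval_subst)

lemma linear_intros:
  "linear (\<lambda>e. c)" "linear (\<lambda>e. e n)"
  "linear f \<Longrightarrow> linear g \<Longrightarrow> linear (\<lambda>e. f e + g e)"
  "linear f \<Longrightarrow> linear (\<lambda>e. c * f e)"
  "linear f \<Longrightarrow> linear g \<Longrightarrow> linear (\<lambda>e. f e - g e)"
proof -
  show "linear (\<lambda>e. c)" unfolding linear_def by (rule exI[of _ "Num c"]) simp
  show "linear (\<lambda>e. e n)" unfolding linear_def by (rule exI[of _ "Var n"]) simp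
  show add: "linear (\<lambda>e. f e + g e)" if "linear f" "linear g" for f g
    using that unfolding linear_def by (metis tval.simps(3))
  show scale: "linear (\<lambda>e. c * f e)" if "linear f" for f c
    using that unfolding linear_def by (metis tval.simps(4))
  show "linear (\<lambda>e. f e - g e)" if "linear f" "linear g"
    using add[OF that(1) scale[OF that(2), of "-1"]] by simp
qed

lemma definable_not: "definable R \<Longrightarrow> definable (\<lambda>e. \<not> R e)"
  unfolding definable_def by (metis sat.simps(3))
lemma definable_and: "definable R \<Longrightarrow> definable S \<Longrightarrow> definable (\<lambda>e. R e \<and> S e)"
  unfolding definable_def by (metis sat.simps(4))
lemma definable_or: "definable R \<Longrightarrow> definable S \<Longrightarrow> definable (\<lambda>e. R e \<or> S e)"
  using definable_not[OF definable_and[OF definable_not definable_not]] by simp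
lemma definable_eq: "linear f \<Longrightarrow> linear g \<Longrightarrow> definable (\<lambda>e. f e = g e)"
  unfolding definable_def linear_def by (metis sat.simps(1))
lemma definable_le: "linear f \<Longrightarrow> linear g \<Longrightarrow> definable (\<lambda>e. f e \<le> g e)"
  unfolding definable_def linear_def by (metis sat.simps(2))
lemma definable_ex:
  assumes "definable (\<lambda>e. R (e 0) (\<lambda>n. e (Suc n)))"
  shows "definable (\<lambda>e. \<exists>x. R x e)"
proof -
  from assms obtain p where p: "\<And>e. sat p e \<longleftrightarrow> R (e 0) (\<lambda>n. e (Suc n))"
    unfolding definable_def by blast
  have "\<forall>e. sat (Ex p) e \<longleftrightarrow> (\<exists>x. R x e)" by (simp add: p)
  then show ?thesis unfolding definable_def by blast
qed
lemma definable_const: "definable (\<lambda>e. P)"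
  using definable_eq[OF linear_intros(1)[of 0] linear_intros(1)[of "if P then 0 else 1"]]
  by (simp split: if_splits)

lemma definable_sat: "(\<And>n. linear (\<lambda>e. f e n)) \<Longrightarrow> definable (\<lambda>e. sat p (f e))"
  unfolding definable_def linear_def
proof -
  assume "\<And>n. \<exists>t. \<forall>e. tval e t = f e n"
  then obtain r where "\<And>n e. tval e (r n) = f e n" by metis
  then have "\<forall>e. sat (subst_pform r p) e \<longleftrightarrow> sat p (f e)" by (simp add: sat_subst)
  then show "\<exists>q. \<forall>e. sat q e \<longleftrightarrow> sat p (f e)" by blast
qed

lemma definable_bex: "finite C \<Longrightarrow> (\<And>c. c \<in> C \<Longrightarrow> definable (R c)) \<Longrightarrow> definable (\<lambda>e. \<exists>c\<in>C. R c e)"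
  by (induction C rule: finite_induct) (auto intro: definable_or definable_const[of False, simplified])

lemma mod_eq_iff: "0 < k \<Longrightarrow> a mod k = c \<longleftrightarrow> 0 \<le> c \<and> c < k \<and> (\<exists>q. a = k * q + c)" for a k c :: int
  by (auto simp: mod_pos_pos_trivial) (metis mult_div_mod_eq)

lemma definable_mod: 
  assumes "linear f" shows "definable (\<lambda>e. f e mod int k = c)"
proof (cases "k = 0")
  case True then show ?thesis using assms by (simp add: definable_eq linear_intros)
next
  case False
  from assms obtain t where t: "\<And>e. tval e t = f e" unfolding linear_def by blast
  have "linear (\<lambda>e. f (\<lambda>n. e (Suc n)))"
    unfolding linear_def t[symmetric]
    by (rule exI[of _ "subst_pterm (\<lambda>n. Var (Suc n)) t"]) (simp add: tval_subst)
  then have "definable (\<lambda>e. 0 \<le> c \<and> c < int k \<and> (\<exists>q. f e = int k * q + c))"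
    by (intro definable_and definable_const definable_ex definable_eq linear_intros)
  then show ?thesis using False by (subst mod_eq_iff) auto
qed

lemma definable_Zmod: "linear f \<Longrightarrow> definable (\<lambda>e. f e \<in> Zmod k)"
proof (cases "k = 0")
  case False
  assume f: "linear f"
  have "(x \<in> Zmod k) = (0 \<le> x \<and> x \<le> int k - 1)" for x
  proof -
    have "0 \<le> x mod int k" "x mod int k < int k" using False by simp_all
    then show ?thesis by (auto simp: Zmod_def)
  qed
  then show ?thesis using f by (simp only:) (intro definable_and definable_le linear_intros)
qed (simp add: Zmod_def definable_const)

lemma linear_valuation_Nil: "linear (\<lambda>e. valuation [] n)"
  using linear_intros(1)[of 0] by (simp add: valuation_def)

lemma linear_valuation_Cons:
  assumes "linear f" "\<And>n. linear (\<lambda>e. valuation (fs e) n)"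
  shows "linear (\<lambda>e. valuation (f e # fs e) n)"
proof (cases n)
  case 0
  then show ?thesis using assms(1) by (simp add: valuation_def)
next
  case (Suc m)
  have "valuation (x # xs) (Suc m) = valuation xs m" for x xs
    by (simp add: valuation_def)
  then show ?thesis using assms(2)[of m] Suc by simp
qed

lemma definable_Nil_eq: "definable (\<lambda>e. [] = c)"
  by (rule definable_const)

lemma definable_Cons_eq:
  assumes "\<And>d. definable (\<lambda>e. f e = d)" "\<And>d. definable (\<lambda>e. fs e = d)"
  shows "definable (\<lambda>e. f e # fs e = c)"
proof (cases c)
  case Nil
  then show ?thesis using definable_const[of False] by simp
next
  case (Cons d ds)
  then show ?thesis using definable_and[OF assms(1)[of d] assms(2)[of ds]] by simp
qed

lemmas definable_intros = definable_const definable_and definable_ex definable_sat definable_Zmod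
  definable_mod definable_Nil_eq definable_Cons_eq definable_eq linear_valuation_Nil
  linear_valuation_Cons linear_intros

lemma finite_Zmod: "k \<noteq> 0 \<Longrightarrow> finite (Zmod k)"
proof -
  assume k: "k \<noteq> 0"
  have "Zmod k \<subseteq> {0..<int k}"
  proof
    fix x assume "x \<in> Zmod k"
    moreover have "0 \<le> x mod int k" "x mod int k < int k" using k by simp_all
    ultimately show "x \<in> {0..<int k}" by (simp add: Zmod_def)
  qed
  then show ?thesis by (rule finite_subset) simp
qed

lemma finite_offsets: "finite (range (offsets [k, l, m]))"
proof (rule finite_subset)
  have "set (offsets ks xs) \<subseteq> {0..<int (Suc (sum_list ks))}" for ks xs
  proof -
    have "x mod int k \<in> {0..<int (Suc (sum_list ks))}" if "(k, y) \<in> set (zip ks xs)" "k \<noteq> 0" for k y x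
    proof -
      have "k \<le> sum_list ks" using that by (auto intro: member_le_sum_list dest: set_zip_leftD)
      moreover have "0 \<le> x mod int k" "x mod int k < int k" using that(2) by simp_all
      ultimately show ?thesis by auto
    qed
    then show ?thesis by (auto simp: offsets_def split: if_splits)
  qed
  moreover have "length (offsets [k, l, m] xs) \<le> 3" for xs
  proof -
    have "length [(x - d) mod int k. (k, x) \<leftarrow> zs, k \<noteq> 0] \<le> length zs" for d zs
      by (induction zs) auto
    from this[of "hd (free_coords [k, l, m] xs)" "zip [k, l, m] xs"] show ?thesis
      by (simp add: offsets_def del: zip_Cons_Cons zip_Cons)
  qed
  ultimately show "range (offsets [k, l, m])
      \<subseteq> {c. set c \<subseteq> {0..<int (Suc (sum_list [k, l, m]))} \<and> length c \<le> 3}"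
    by blast
  show "finite {c. set c \<subseteq> {0..<int (Suc (sum_list [k, l, m]))} \<and> length c \<le> 3}"
    by (rule finite_lists_length_le) simp
qed

definition monomial_set :: "nat \<Rightarrow> nat \<Rightarrow> nat \<Rightarrow> pform \<Rightarrow> int list set" where
  "monomial_set k l m p = {[x, y, z] | x y z.
     x \<in> Zmod k \<and> y \<in> Zmod l \<and> z \<in> Zmod m \<and> sat p (valuation [x, y, z])}"

lemma semilinear_monomial_set: "semilinear_monomial [k, l, m] (monomial_set k l m p)"
  unfolding semilinear_monomial_def
proof (intro impI allI)
  fix c
  let ?ks = "[k, l, m]" let ?n = "count_list ?ks 0"
  assume 0: "0 \<in> set ?ks"
  have "definable (\<lambda>e. \<exists>x y z. x \<in> Zmod k \<and> y \<in> Zmod l \<and> z \<in> Zmod m \<and> sat p (valuation [x, y, z])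
      \<and> offsets ?ks [x, y, z] = c \<and> free_coords ?ks [x, y, z] = map e [0..<?n])"
    using 0
    by (cases "k = 0"; cases "l = 0"; cases "m = 0";
        simp add: offsets_def free_coords_def upt_rec; intro definable_intros)
  then obtain q where q: "sat q e \<longleftrightarrow> (\<exists>x y z. x \<in> Zmod k \<and> y \<in> Zmod l \<and> z \<in> Zmod m
      \<and> sat p (valuation [x, y, z]) \<and> offsets ?ks [x, y, z] = c
      \<and> free_coords ?ks [x, y, z] = map e [0..<?n])" for e
    unfolding definable_def by blast
  have map: "map (valuation ys) [0..<?n] = ys" if "length ys = ?n" for ys
    using that by (intro nth_equalityI) (auto simp: valuation_def)
  have len: "length (free_coords ?ks [x, y, z]) = ?n" for x y z
    by (simp add: free_coords_def)
  have "free_coords ?ks ` {xs \<in> monomial_set k l m p. offsets ?ks xs = c}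
      = {ys. length ys = ?n \<and> sat q (valuation ys)}"
  proof (intro Set.set_eqI iffI)
    fix ys assume "ys \<in> free_coords ?ks ` {xs \<in> monomial_set k l m p. offsets ?ks xs = c}"
    then obtain x y z where *: "x \<in> Zmod k" "y \<in> Zmod l" "z \<in> Zmod m" "sat p (valuation [x, y, z])"
      "offsets ?ks [x, y, z] = c" "ys = free_coords ?ks [x, y, z]"
      unfolding monomial_set_def by blast
    then have "length ys = ?n" using len by blast
    moreover from map[OF this] * have "sat q (valuation ys)" unfolding q by metis
    ultimately show "ys \<in> {ys. length ys = ?n \<and> sat q (valuation ys)}" by blast
  next
    fix ys assume "ys \<in> {ys. length ys = ?n \<and> sat q (valuation ys)}"
    then have n: "length ys = ?n" and "sat q (valuation ys)" by blast+
    then obtain x y z where "x \<in> Zmod k" "y \<in> Zmod l" "z \<in> Zmod m" "sat p (valuation [x, y, z])"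
      "offsets ?ks [x, y, z] = c" "free_coords ?ks [x, y, z] = ys"
      unfolding q map[OF n] by blast
    then show "ys \<in> free_coords ?ks ` {xs \<in> monomial_set k l m p. offsets ?ks xs = c}"
      unfolding monomial_set_def image_def by blast
  qed
  then show "semilinear ?n (free_coords ?ks ` {xs \<in> monomial_set k l m p. offsets ?ks xs = c})"
    unfolding semilinear_def by blast
qed

lemma Zmod_offset_inj:
  assumes "x \<in> Zmod k" "y \<in> Zmod k" "(x - c) mod int k = (y - c) mod int k"
  shows "x = y"
  using mod_add_cong[OF assms(3) refl, of c] assms(1,2) by (simp add: Zmod_def)

lemma coords_inj:
  assumes "0 \<in> set [k, l, m]"
    and "x \<in> Zmod k" "y \<in> Zmod l" "z \<in> Zmod m" "x' \<in> Zmod k" "y' \<in> Zmod l" "z' \<in> Zmod m"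
    and "offsets [k, l, m] [x, y, z] = offsets [k, l, m] [x', y', z']"
    and "free_coords [k, l, m] [x, y, z] = free_coords [k, l, m] [x', y', z']"
  shows "[x, y, z] = [x', y', z']"
  using assms
  by (cases "k = 0"; cases "l = 0"; cases "m = 0")
    (auto simp: offsets_def free_coords_def dest: Zmod_offset_inj)

lemma monomial_setI:
  assumes S: "S \<subseteq> {[x, y, z] | x y z. x \<in> Zmod k \<and> y \<in> Zmod l \<and> z \<in> Zmod m}"
    and "semilinear_monomial [k, l, m] S"
  shows "\<exists>p. S = monomial_set k l m p"
proof -
  let ?ks = "[k, l, m]" let ?n = "count_list ?ks 0"
  have len: "length (free_coords ?ks [x, y, z]) = ?n" for x y z
    by (simp add: free_coords_def)
  have "\<exists>R. definable R \<and> (\<forall>x\<in>Zmod k. \<forall>y\<in>Zmod l. \<forall>z\<in>Zmod m.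
      R (valuation [x, y, z]) \<longleftrightarrow> [x, y, z] \<in> S)"
  proof (cases "0 \<in> set ?ks")
    case False
    have "finite ((\<lambda>(x, y, z). [x, y, z]) ` (Zmod k \<times> Zmod l \<times> Zmod m))"
      using False by (simp add: finite_Zmod)
    then have fin: "finite S" by (rule finite_subset[rotated]) (use S in force)
    have "definable (\<lambda>e. \<exists>c\<in>S. [e 0, e 1, e 2] = c)"
      by (intro definable_bex fin definable_intros)
    then show ?thesis by (intro exI conjI) (auto simp: valuation_def)
  next
    case True
    let ?I = "\<lambda>c. free_coords ?ks ` {xs \<in> S. offsets ?ks xs = c}"
    from True assms(2) have "\<forall>c. \<exists>p. ?I c = {ys. length ys = ?n \<and> sat p (valuation ys)}"
      unfolding semilinear_monomial_def semilinear_def by blast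
    then obtain p where p: "\<And>c. ?I c = {ys. length ys = ?n \<and> sat (p c) (valuation ys)}" by metis
    let ?R = "\<lambda>e. \<exists>c\<in>range (offsets ?ks). offsets ?ks [e 0, e 1, e 2] = c
        \<and> sat (p c) (valuation (free_coords ?ks [e 0, e 1, e 2]))"
    have "definable (\<lambda>e. offsets ?ks [e 0, e 1, e 2] = c
        \<and> sat (p c) (valuation (free_coords ?ks [e 0, e 1, e 2])))" for c
      using True by (cases "k = 0"; cases "l = 0"; cases "m = 0";
        simp add: offsets_def free_coords_def; intro definable_intros)
    then have "definable ?R" by (intro definable_bex finite_offsets)
    moreover have "?R (valuation [x, y, z]) \<longleftrightarrow> [x, y, z] \<in> S"
      if *: "x \<in> Zmod k" "y \<in> Zmod l" "z \<in> Zmod m" for x y z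
    proof -
      have "?R (valuation [x, y, z])
          \<longleftrightarrow> free_coords ?ks [x, y, z] \<in> ?I (offsets ?ks [x, y, z])"
        unfolding p by (auto simp: valuation_def len simp del: count_list.simps)
      also have "\<dots> \<longleftrightarrow> [x, y, z] \<in> S"
      proof
        assume "free_coords ?ks [x, y, z] \<in> ?I (offsets ?ks [x, y, z])"
        then obtain xs where xs: "xs \<in> S" "offsets ?ks xs = offsets ?ks [x, y, z]"
          "free_coords ?ks xs = free_coords ?ks [x, y, z]" by auto
        then obtain x' y' z' where "xs = [x', y', z']" "x' \<in> Zmod k" "y' \<in> Zmod l" "z' \<in> Zmod m"
          using S by blast
        with xs coords_inj[OF True this(2-4) *] show "[x, y, z] \<in> S" by simp
      qed blast
      finally show ?thesis .
    qed
    ultimately show ?thesis by blast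
  qed
  then obtain p where "\<And>x y z. x \<in> Zmod k \<Longrightarrow> y \<in> Zmod l \<Longrightarrow> z \<in> Zmod m \<Longrightarrow>
      sat p (valuation [x, y, z]) \<longleftrightarrow> [x, y, z] \<in> S"
    unfolding definable_def by metis
  then have "S = monomial_set k l m p" using S unfolding monomial_set_def by blast
  then show ?thesis ..
qed

lemma semilinear_nfa_nfa_of: "semilinear_nfa (nfa_of D)"
proof -
  let ?ks = "state_chars D" and ?ls = "letter_chars D"
  have ch: "chart (orbit_sum ks) (shift ks) ks (\<lambda>q. q)" for ks
    by (simp add: chart_def bij_betw_id[unfolded id_def])
  have "semilinear_monomial [?ks ! i, ?ls ! a, ?ks ! j]
      {[x, y, z] | x y z. \<exists>(q, l, q') \<in> transitions (nfa_of D).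
         q = (i, x) \<and> l = (a, y) \<and> q' = (j, z)}"
    if "i < length ?ks" "a < length ?ls" "j < length ?ks" for i a j
  proof -
    have "definable (\<lambda>e. \<exists>p\<in>{p. (i, a, j, p) \<in> set (trans_forms D)}. sat p e)"
    proof (rule definable_bex)
      have "{p. (i, a, j, p) \<in> set (trans_forms D)} \<subseteq> (\<lambda>(i, a, j, p). p) ` set (trans_forms D)"
        by force
      then show "finite {p. (i, a, j, p) \<in> set (trans_forms D)}"
        by (rule finite_subset) simp
    qed (auto simp: definable_def)
    then obtain q where q: "\<And>e. sat q e \<longleftrightarrow> (\<exists>p. (i, a, j, p) \<in> set (trans_forms D) \<and> sat p e)"
      unfolding definable_def by auto
    have "{[x, y, z] | x y z. \<exists>(q, l, q') \<in> transitions (nfa_of D).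
         q = (i, x) \<and> l = (a, y) \<and> q' = (j, z)} = monomial_set (?ks ! i) (?ls ! a) (?ks ! j) q"
      using that by (simp add: monomial_set_def nfa_of_def orbit_sum_def q)
    then show ?thesis using semilinear_monomial_set by simp
  qed
  note monomials = this
  have charts: "chart (states (nfa_of D)) (state_act (nfa_of D)) ?ks (\<lambda>q. q)"
    "chart (letters (nfa_of D)) (letter_act (nfa_of D)) ?ls (\<lambda>q. q)"
    using ch by (simp_all add: nfa_of_def)
  show ?thesis
    unfolding semilinear_nfa_def
    by (rule exI[of _ ?ks], rule exI[of _ "\<lambda>q. q"], rule exI[of _ ?ls],
        rule exI[of _ "\<lambda>q. q"]) (intro conjI charts allI impI monomials)
qed

definition same_nfa ::
    "('q \<Rightarrow> 'r) \<Rightarrow> ('a \<Rightarrow> 'b) \<Rightarrow> ('q, 'a) nfa \<Rightarrow> ('r, 'b) nfa \<Rightarrow> bool" where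
  "same_nfa f g M N \<longleftrightarrow>
     bij_betw f (states M) (states N) \<and> bij_betw g (letters M) (letters N) \<and>
     (\<forall>q\<in>states M. \<forall>z. f (state_act M z q) = state_act N z (f q)) \<and>
     (\<forall>a\<in>letters M. \<forall>z. g (letter_act M z a) = letter_act N z (g a)) \<and>
     transitions N = (\<lambda>(q, a, q'). (f q, g a, f q')) ` transitions M \<and>
     initial N = f ` initial M \<and> accepting N = f ` accepting M"

lemma subset_union_of_orbits:
  assumes f: "chart X act ks f" and S: "S \<subseteq> X" "equivariant_subset act S"
  shows "\<exists>os. f ` S = {(i, x) \<in> orbit_sum ks. i \<in> set os}"
proof -
  have bij: "bij_betw f X (orbit_sum ks)" and eq: "\<And>x z. x \<in> X \<Longrightarrow> f (act z x) = shift ks z (f x)"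
    using f unfolding chart_def by blast+
  have fS: "f ` S \<subseteq> orbit_sum ks" using bij S(1) by (auto simp: bij_betw_def)
  then have "fst ` f ` S \<subseteq> {..<length ks}" by (auto simp: orbit_sum_def)
  then have fin: "finite (fst ` f ` S)" by (rule finite_subset) simp
  obtain os where os: "set os = fst ` f ` S" by (rule exE[OF finite_list[OF fin]])
  have "(i, y) \<in> f ` S" if iy: "(i, y) \<in> orbit_sum ks" and i: "i \<in> set os" for i y
  proof -
    from i obtain s where s: "s \<in> S" "i = fst (f s)" unfolding os by blast
    define x where "x = snd (f s)"
    have fs: "f s = (i, x)" using s(2) by (simp add: x_def)
    have "(i, x) \<in> orbit_sum ks" using s(1) fS unfolding fs[symmetric] by blast
    then have "shift ks (y - x) (i, x) = (i, y)"
      using iy by (simp add: shift_def orbit_sum_def Zmod_def)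
    then have "f (act (y - x) s) = (i, y)" using eq[of s "y - x"] s(1) S(1) fs by (simp add: subset_iff)
    moreover have "act (y - x) s \<in> S"
      using S(2) s(1) unfolding equivariant_subset_def by blast
    ultimately show ?thesis by (rule image_eqI[OF sym])
  qed
  note orbit = this
  have "f ` S = {(i, x) \<in> orbit_sum ks. i \<in> set os}"
  proof (intro Set.set_eqI iffI)
    fix q assume "q \<in> f ` S"
    moreover then have "q \<in> orbit_sum ks" "fst q \<in> set os" using fS unfolding os by blast+
    ultimately show "q \<in> {(i, x) \<in> orbit_sum ks. i \<in> set os}" by (cases q) simp
  next
    fix q assume "q \<in> {(i, x) \<in> orbit_sum ks. i \<in> set os}"
    then show "q \<in> f ` S" by (cases q) (simp add: orbit)
  qed
  then show ?thesis by (rule exI)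
qed

lemma equivariant_image:
  assumes "equivariant_subset h S" "\<And>x z. x \<in> S \<Longrightarrow> h' z (k x) = k (h z x)"
  shows "equivariant_subset h' (k ` S)"
proof -
  have "h' z ` k ` S = k ` h z ` S" for z using assms(2) by (simp add: image_image)
  then show ?thesis using assms(1) by (simp add: equivariant_subset_def)
qed

lemma same_nfa_equivariant:
  assumes same: "same_nfa f g M N" and M: "nfa_with_atoms M" and eqv: "equivariant_nfa M"
  shows "equivariant_nfa N"
proof -
  have T: "transitions M \<subseteq> states M \<times> letters M \<times> states M" and I: "initial M \<subseteq> states M"
    and F: "accepting M \<subseteq> states M" using M by (auto simp: nfa_with_atoms_def)
  have tr: "transitions N = (\<lambda>(q, a, q'). (f q, g a, f q')) ` transitions M"
    and ini: "initial N = f ` initial M" and acc: "accepting N = f ` accepting M"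
    and act: "\<And>q z. q \<in> states M \<Longrightarrow> state_act N z (f q) = f (state_act M z q)"
      "\<And>a z. a \<in> letters M \<Longrightarrow> letter_act N z (g a) = g (letter_act M z a)"
    using same by (auto simp: same_nfa_def)
  have "equivariant_subset (trans_act N) (transitions N)"
    unfolding tr using eqv T act
    by (intro equivariant_image[where h = "trans_act M"])
      (auto simp: trans_act_def equivariant_nfa_def subset_iff)
  moreover have "equivariant_subset (state_act N) (initial N)"
    unfolding ini using eqv I act(1)
    by (intro equivariant_image[where h = "state_act M"]) (auto simp: equivariant_nfa_def)
  moreover have "equivariant_subset (state_act N) (accepting N)"
    unfolding acc using eqv F act(1)
    by (intro equivariant_image[where h = "state_act M"]) (auto simp: equivariant_nfa_def)
  ultimately show ?thesis by (simp add: equivariant_nfa_def)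
qed

lemma description_exists:
  assumes M: "nfa_with_atoms M" and eqv: "equivariant_nfa M" and sl: "semilinear_nfa M"
  shows "\<exists>D f g. same_nfa f g M (nfa_of D) \<and> equivariant_nfa (nfa_of D)"
proof -
  from sl obtain ks f ls g where f: "chart (states M) (state_act M) ks f"
    and g: "chart (letters M) (letter_act M) ls g"
    and sm: "\<And>i a j. i < length ks \<Longrightarrow> a < length ls \<Longrightarrow> j < length ks \<Longrightarrow>
      semilinear_monomial [ks ! i, ls ! a, ks ! j]
        {[x, y, z] | x y z. \<exists>(q, l, q') \<in> transitions M. f q = (i, x) \<and> g l = (a, y) \<and> f q' = (j, z)}"
      (is "\<And>i a j. _ \<Longrightarrow> _ \<Longrightarrow> _ \<Longrightarrow> semilinear_monomial _ (?S i a j)")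
    unfolding semilinear_nfa_def by auto
  have tr: "f q \<in> orbit_sum ks" "g a \<in> orbit_sum ls" "f q' \<in> orbit_sum ks"
    if "(q, a, q') \<in> transitions M" for q a q'
    using that M f g unfolding nfa_with_atoms_def chart_def by (auto dest!: bij_betwE)
  have "\<exists>p. ?S i a j = monomial_set (ks ! i) (ls ! a) (ks ! j) p"
    if "i < length ks" "a < length ls" "j < length ks" for i a j
  proof (rule monomial_setI[OF _ sm[OF that]])
    show "?S i a j \<subseteq> {[x, y, z] | x y z. x \<in> Zmod (ks ! i) \<and> y \<in> Zmod (ls ! a) \<and> z \<in> Zmod (ks ! j)}"
    proof
      fix xs assume "xs \<in> ?S i a j"
      then obtain x y z q l q' where "xs = [x, y, z]" and t: "(q, l, q') \<in> transitions M"
        and "f q = (i, x)" "g l = (a, y)" "f q' = (j, z)" by blast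
      with tr[OF t] show "xs \<in> {[x, y, z] | x y z.
          x \<in> Zmod (ks ! i) \<and> y \<in> Zmod (ls ! a) \<and> z \<in> Zmod (ks ! j)}"
        by (simp add: orbit_sum_def)
    qed
  qed
  note ex = this
  define p where "p i a j = (SOME p. ?S i a j = monomial_set (ks ! i) (ls ! a) (ks ! j) p)" for i a j
  have p: "?S i a j = monomial_set (ks ! i) (ls ! a) (ks ! j) (p i a j)"
    if "i < length ks" "a < length ls" "j < length ks" for i a j
    unfolding p_def by (rule someI_ex) (rule ex[OF that])
  have sub: "initial M \<subseteq> states M" "accepting M \<subseteq> states M"
    using M by (simp_all add: nfa_with_atoms_def)
  have eq: "equivariant_subset (state_act M) (initial M)" "equivariant_subset (state_act M) (accepting M)"
    using eqv by (simp_all add: equivariant_nfa_def)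
  obtain os where os: "f ` initial M = {(i, x) \<in> orbit_sum ks. i \<in> set os}"
    by (rule exE[OF subset_union_of_orbits[OF f sub(1) eq(1)]])
  obtain fs where fs: "f ` accepting M = {(i, x) \<in> orbit_sum ks. i \<in> set fs}"
    by (rule exE[OF subset_union_of_orbits[OF f sub(2) eq(2)]])
  have fin: "finite ((\<lambda>(i, a, j). (i, a, j, p i a j)) `
      ({..<length ks} \<times> {..<length ls} \<times> {..<length ks}))"
    by simp
  obtain ts where ts: "set ts = (\<lambda>(i, a, j). (i, a, j, p i a j)) `
      ({..<length ks} \<times> {..<length ls} \<times> {..<length ks})"
    by (rule exE[OF finite_list[OF fin]])
  have entry: "(i, a, j, r) \<in> set ts \<longleftrightarrow> i < length ks \<and> a < length ls \<and> j < length ks \<and> r = p i a j"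
    for i a j r
    unfolding ts by (auto simp: image_iff)
  define D where "D = \<lparr>state_chars = ks, letter_chars = ls, init_orbits = os, acc_orbits = fs,
    trans_forms = ts\<rparr>"
  have "((i, x), (a, y), (j, z)) \<in> transitions (nfa_of D) \<longleftrightarrow>
      ((i, x), (a, y), (j, z)) \<in> (\<lambda>(q, a, q'). (f q, g a, f q')) ` transitions M" for i x a y j z
  proof -
    have "((i, x), (a, y), (j, z)) \<in> transitions (nfa_of D) \<longleftrightarrow>
        i < length ks \<and> a < length ls \<and> j < length ks \<and>
        [x, y, z] \<in> monomial_set (ks ! i) (ls ! a) (ks ! j) (p i a j)"
      by (auto simp: nfa_of_def D_def monomial_set_def orbit_sum_def entry)
    also have "\<dots> \<longleftrightarrow> i < length ks \<and> a < length ls \<and> j < length ks \<and> [x, y, z] \<in> ?S i a j"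
      by (intro conj_cong refl) (simp only: p)
    also have "\<dots> \<longleftrightarrow> ((i, x), (a, y), (j, z)) \<in> (\<lambda>(q, a, q'). (f q, g a, f q')) ` transitions M"
    proof
      assume "i < length ks \<and> a < length ls \<and> j < length ks \<and> [x, y, z] \<in> ?S i a j"
      then obtain q l q' where t: "(q, l, q') \<in> transitions M"
        and "f q = (i, x)" "g l = (a, y)" "f q' = (j, z)" by auto
      then show "((i, x), (a, y), (j, z)) \<in> (\<lambda>(q, a, q'). (f q, g a, f q')) ` transitions M"
        by (intro image_eqI[OF _ t]) simp
    next
      assume "((i, x), (a, y), (j, z)) \<in> (\<lambda>(q, a, q'). (f q, g a, f q')) ` transitions M"
      then obtain q l q' where t: "(q, l, q') \<in> transitions M"
        and *: "f q = (i, x)" "g l = (a, y)" "f q' = (j, z)" by auto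
      have "i < length ks" "a < length ls" "j < length ks"
        using tr[OF t] * by (simp_all add: orbit_sum_def)
      moreover have "[x, y, z] \<in> ?S i a j" using t * by blast
      ultimately show "i < length ks \<and> a < length ls \<and> j < length ks \<and> [x, y, z] \<in> ?S i a j"
        by blast
    qed
    finally show ?thesis .
  qed
  then have trD: "transitions (nfa_of D) = (\<lambda>(q, a, q'). (f q, g a, f q')) ` transitions M"
    by (simp only: Set.set_eq_iff split_paired_All) simp
  have flds: "states (nfa_of D) = orbit_sum ks" "letters (nfa_of D) = orbit_sum ls"
    "state_act (nfa_of D) = shift ks" "letter_act (nfa_of D) = shift ls"
    "initial (nfa_of D) = {(i, x) \<in> orbit_sum ks. i \<in> set os}"
    "accepting (nfa_of D) = {(i, x) \<in> orbit_sum ks. i \<in> set fs}"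
    by (simp_all add: nfa_of_def D_def)
  have same: "same_nfa f g M (nfa_of D)"
    using f g unfolding same_nfa_def flds trD os fs chart_def by blast
  show ?thesis
    by (rule exI[of _ D], rule exI[of _ f], rule exI[of _ g])
      (intro conjI same same_nfa_equivariant[OF same M eqv])
qed

lemma same_nfa_language:
  assumes same: "same_nfa f g M N" and M: "nfa_with_atoms M"
  shows "language N = map g ` language M"
proof -
  have T: "transitions M \<subseteq> states M \<times> letters M \<times> states M" and I: "initial M \<subseteq> states M"
    and F: "accepting M \<subseteq> states M" using M by (auto simp: nfa_with_atoms_def)
  have inj: "inj_on f (states M)" and letters: "letters N = g ` letters M"
    and tr: "transitions N = (\<lambda>(q, a, q'). (f q, g a, f q')) ` transitions M"
    and ini: "initial N = f ` initial M" and acc: "accepting N = f ` accepting M"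
    using same by (auto simp: same_nfa_def bij_betw_def)
  have forward: "run N (f q) (map g w) (f q')" if "run M q w q'" for q w q'
    using that
  proof induction
    case (2 q a q' w q'')
    have "(f q, g a, f q') \<in> transitions N"
      unfolding tr by (rule image_eqI[OF _ 2(1)]) simp
    with 2(3) show ?case by (simp add: run.intros(2))
  qed (simp add: run.intros(1))
  have backward: "\<exists>w q'. v = map g w \<and> r' = f q' \<and> q' \<in> states M \<and> w \<in> lists (letters M) \<and> run M q w q'"
    if "run N r v r'" "r = f q" "q \<in> states M" for r v r' q
    using that
  proof (induction arbitrary: q)
    case (1 r)
    then show ?case by (intro exI[of _ "[]"] exI[of _ q]) (auto intro: run.intros)
  next
    case (2 r b r' v r'')
    then obtain q0 a q' where t: "(q0, a, q') \<in> transitions M" "r = f q0" "b = g a" "r' = f q'"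
      by (auto simp: tr)
    with T have *: "q0 \<in> states M" "a \<in> letters M" "q' \<in> states M" by auto
    with t(2) "2.prems" inj have "q0 = q" by (auto dest: inj_onD)
    from "2.IH"[OF t(4) *(3)] obtain w q'' where "v = map g w" "r'' = f q''" "q'' \<in> states M"
      "w \<in> lists (letters M)" "run M q' w q''" by blast
    with t * \<open>q0 = q\<close> show ?case
      by (intro exI[of _ "a # w"] exI[of _ q'']) (auto intro: run.intros)
  qed
  show ?thesis
  proof (intro Set.set_eqI iffI)
    fix v assume "v \<in> language N"
    then obtain q r where q: "q \<in> initial M" and r: "r \<in> accepting M" and v: "run N (f q) v (f r)"
      by (auto simp: language_def ini acc)
    from backward[OF v refl] q I obtain w q' where w: "v = map g w" "f r = f q'" "q' \<in> states M"
      "w \<in> lists (letters M)" "run M q w q'" by blast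
    with r F inj have "q' = r" by (auto dest: inj_onD)
    with w q r show "v \<in> map g ` language M" by (auto simp: language_def)
  next
    fix v assume "v \<in> map g ` language M"
    then show "v \<in> language N" by (auto simp: language_def ini acc letters dest: forward)
  qed
qed

end

theory Submission
  imports Defs
begin

text \<open>
  By equivariance, a state of an orbit can take a transition to another orbit iff all states of the
  orbit can. So emptiness is unreachability in the finite graph of orbits, whose edges are given by
  Presburger sentences. Truth of these is decided by bounded search: an Ehrenfeucht-Fraisse argument
  in the style of Ferrante and Rackoff shows that tuples which satisfy the same linear inequalities
  with small coefficients and agree modulo a suitable number satisfy the same formulas of small
  quantifier rank, and a large witness can be shifted towards the origin without leaving its class.
  To avoid a recursive evaluator, the program searches for a finite set of facts about subformulas
  that justify each other; it exists and determines the truth values.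
\<close>

section \<open>Bounded quantifiers suffice for Presburger arithmetic\<close>

text \<open>Two demands shape the proof. First, the bound on witnesses must be computable from the
  input number without parsing formulas. Norms are at most exponential in codes, ranks are at most
  the codes, and the code of an edge sentence is monotone in the numbers that occur in the input; so
  one bound serves all edge sentences at once. Bounding quantifiers also leaves the formulas as they
  are, whereas eliminating them would mean rewriting codes. Second, the blind search must halt and
  must not be misled. Certificates exist for every search bound \<open>M\<close>; the size of
  \<open>M\<close> matters only for soundness, and there only where an existential formula is
  refuted. Equivariance is a promise on the input: the procedure relies on it and does not test
  it.\<close>

definition lin :: "nat \<Rightarrow> (nat \<Rightarrow> int) \<Rightarrow> int \<Rightarrow> (nat \<Rightarrow> int) \<Rightarrow> int" where
  "lin k c d e = d + (\<Sum>i<k. c i * e i)"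

text \<open>One number is both the modulus and the bound on coefficients, so a single parameter is
  iterated. Comparison with 0 in one direction is enough, as the admissible coefficients are closed
  under negation.\<close>

definition sim :: "nat \<Rightarrow> nat \<Rightarrow> (nat \<Rightarrow> int) \<Rightarrow> (nat \<Rightarrow> int) \<Rightarrow> bool" where
  "sim k n e e' \<longleftrightarrow> (\<forall>i<k. int n dvd e i - e' i) \<and>
     (\<forall>c d. (\<forall>i<k. \<bar>c i\<bar> \<le> int n) \<longrightarrow> \<bar>d\<bar> \<le> int n \<longrightarrow> (lin k c d e \<le> 0 \<longleftrightarrow> lin k c d e' \<le> 0))"

text \<open>\<open>fact n\<close> is a common multiple of 1, ..., n, so an atom in a new variable
  can be scaled to leading coefficient plus or minus \<open>fact n\<close>; its other coefficients
  then have absolute value at most \<open>fact n * n\<close>. The factor 3 pays for the difference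
  of two such forms and a shift of that size.\<close>

definition sim_step :: "nat \<Rightarrow> nat" where
  "sim_step n = 3 * fact n * n"

lemma sim_mod: "sim k n e e' \<Longrightarrow> i < k \<Longrightarrow> int n dvd e i - e' i"
  by (simp add: sim_def)

lemma sim_sign:
  "sim k n e e' \<Longrightarrow> (\<And>i. i < k \<Longrightarrow> \<bar>c i\<bar> \<le> int n) \<Longrightarrow> \<bar>d\<bar> \<le> int n \<Longrightarrow>
    lin k c d e \<le> 0 \<longleftrightarrow> lin k c d e' \<le> 0"
  by (simp add: sim_def)

lemma sim_sym: "sim k n e e' \<Longrightarrow> sim k n e' e"
  by (simp add: sim_def dvd_diff_commute)

lemma sim_dvd:
  assumes "sim k n e e'" "m dvd n" "0 < n"
  shows "sim k m e e'"
proof -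
  have "int m dvd int n" and "int m \<le> int n"
    using assms(2,3) by (auto dest: dvd_imp_le)
  then show ?thesis
    using assms(1) unfolding sim_def by (meson dvd_trans order_trans)
qed

lemma sim_step_pos: "0 < n \<Longrightarrow> 0 < sim_step n"
  by (simp add: sim_step_def)

lemma dvd_sim_step: "n dvd sim_step n"
  by (simp add: sim_step_def)

lemma lin_Suc: "lin (Suc k) c d (case_nat x e) = c 0 * x + lin k (\<lambda>i. c (Suc i)) d e"
  by (simp add: lin_def sum.lessThan_Suc_shift del: sum.lessThan_Suc)

lemma lin_diff: "lin k c d e - lin k c' d' e - g = lin k (\<lambda>i. c i - c' i) (d - d' - g) e"
  by (simp add: lin_def sum_subtractf algebra_simps)

lemma lin_scale: "q * lin k c d e = lin k (\<lambda>i. q * c i) (q * d) e"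
  by (simp add: lin_def algebra_simps sum_distrib_left)

lemma lin_dvd:
  assumes "\<And>i. i < k \<Longrightarrow> m dvd e i - e' i"
  shows "m dvd lin k c d e - lin k c d e'"
proof -
  have "lin k c d e - lin k c d e' = (\<Sum>i<k. c i * (e i - e' i))"
    by (simp add: lin_def sum_subtractf algebra_simps)
  then show ?thesis using assms by (auto intro!: dvd_sum)
qed

text \<open>The forth step of the game, and by \<open>sim_sym\<close> also the back step.
  \<open>Q * y\<close> must lie among the values of the small forms at \<open>e'\<close> as
  \<open>Q * x\<close> does among those at \<open>e\<close>. So \<open>Q * x\<close> is first
  replaced by a point \<open>u + g\<close> near the closest value \<open>u\<close>, which is then
  copied to \<open>u' + g\<close>.\<close>

lemma sim_extend:
  assumes n: "0 < n" and sim: "sim k (sim_step n) e e'"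
  shows "\<exists>y. sim (Suc k) n (case_nat x e) (case_nat y e')"
proof -
  define Q where "Q = (fact n :: int)"
  define B where "B = Q * int n"
  have Q: "0 < Q" and B: "0 < B" using n by (simp_all add: Q_def B_def)
  have step: "int (sim_step n) = 3 * B" by (simp add: sim_step_def Q_def B_def)
  have nB: "int n \<le> B" using Q n by (simp add: B_def)
  define small where "small = (\<lambda>(c :: nat \<Rightarrow> int, d). (\<forall>i<k. \<bar>c i\<bar> \<le> B) \<and> \<bar>d\<bar> \<le> B)"
  \<comment> \<open>The zero form makes the class nonempty, so a form with value nearest to
    \<open>Q * x\<close> exists.\<close>
  have "small (\<lambda>_. 0, 0)" using B by (simp add: small_def)
  from ex_has_least_nat[of small, OF this, of "\<lambda>(c, d). nat \<bar>Q * x - lin k c d e\<bar>"]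
  obtain c0 d0 where u: "small (c0, d0)"
    and least: "\<And>c d. small (c, d) \<Longrightarrow> \<bar>Q * x - lin k c0 d0 e\<bar> \<le> \<bar>Q * x - lin k c d e\<bar>"
    by (fastforce simp: nat_le_eq_zle)
  define u where "u = lin k c0 d0 e"
  define u' where "u' = lin k c0 d0 e'"
  \<comment> \<open>Only the nearest threshold \<open>u\<close> matters, and the distance to it only modulo \<open>B\<close> once it exceeds \<open>B\<close>.\<close>
  have "\<exists>g. \<bar>g\<bar> \<le> B \<and> B dvd Q * x - u - g \<and> (\<forall>c d. small (c, d) \<longrightarrow>
      (lin k c d e \<le> Q * x \<longleftrightarrow> lin k c d e \<le> u + g) \<and> (Q * x \<le> lin k c d e \<longleftrightarrow> u + g \<le> lin k c d e))"
  proof -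
    consider "\<bar>Q * x - u\<bar> \<le> B" | "Q * x - u > B" | "u - Q * x > B" by linarith
    then show ?thesis
    proof cases
      case 1
      then show ?thesis by (intro exI[of _ "Q * x - u"]) simp
    next
      case 2
      \<comment> \<open>Residues 1 to \<open>B\<close> instead of 0 to \<open>B - 1\<close>:
        \<open>u\<close> is strictly below \<open>Q * x\<close> and must stay strictly below
        \<open>u + g\<close>. By the choice of \<open>u\<close>, no small form has a value above
        \<open>u\<close> and at most \<open>Q * x\<close>.\<close>
      define g where "g = (Q * x - u - 1) mod B + 1"
      have g: "1 \<le> g" "g \<le> B" using B by (simp_all add: g_def zmod_le_nonneg_dividend)
          (smt (verit) pos_mod_bound pos_mod_sign)+
      have "B dvd Q * x - u - g" unfolding g_def
        by (metis add_diff_cancel_right' diff_diff_add dvd_minus_mod add.commute)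
      moreover have "(lin k c d e \<le> Q * x \<longleftrightarrow> lin k c d e \<le> u + g) \<and> (Q * x \<le> lin k c d e \<longleftrightarrow> u + g \<le> lin k c d e)"
        if "small (c, d)" for c d
        using least[OF that] 2 g unfolding u_def by linarith
      ultimately show ?thesis using g by (intro exI[of _ g]) auto
    next
      case 3
      define g where "g = (u - Q * x - 1) mod B + 1"
      have g: "1 \<le> g" "g \<le> B" using B by (simp_all add: g_def zmod_le_nonneg_dividend)
          (smt (verit) pos_mod_bound pos_mod_sign)+
      have "B dvd u - Q * x - g" unfolding g_def
        by (metis add_diff_cancel_right' diff_diff_add dvd_minus_mod add.commute)
      then have "B dvd - (u - Q * x - g)" by (simp only: dvd_minus_iff)
      then have "B dvd Q * x - u - (- g)" by (simp add: algebra_simps)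
      moreover have "(lin k c d e \<le> Q * x \<longleftrightarrow> lin k c d e \<le> u + - g) \<and> (Q * x \<le> lin k c d e \<longleftrightarrow> u + - g \<le> lin k c d e)"
        if "small (c, d)" for c d
        using least[OF that] 3 g unfolding u_def by linarith
      ultimately show ?thesis using g by (intro exI[of _ "- g"]) auto
    qed
  qed
  then obtain g where g: "\<bar>g\<bar> \<le> B" and gx: "B dvd Q * x - u - g"
    and lower: "\<And>c d. small (c, d) \<Longrightarrow> lin k c d e \<le> Q * x \<longleftrightarrow> lin k c d e \<le> u + g"
    and upper: "\<And>c d. small (c, d) \<Longrightarrow> Q * x \<le> lin k c d e \<longleftrightarrow> u + g \<le> lin k c d e"
    by blast
  have "B dvd u - u'"
    unfolding u_def u'_def using sim_mod[OF sim] step by (intro lin_dvd) (metis dvd_mult_right)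
  then have "B dvd Q * x - u - g + (u - u')" using gx by (rule dvd_add[rotated])
  then have "B dvd - (Q * x - u - g + (u - u'))" by (simp only: dvd_minus_iff)
  then obtain s where s: "- (Q * x - u - g + (u - u')) = B * s" by (auto elim: dvdE)
  \<comment> \<open>As \<open>B = Q * n\<close>, the congruence says
    \<open>u' + g = Q * x + Q * n * s\<close>: division by \<open>Q\<close> is exact, and
    \<open>y\<close> is congruent to \<open>x\<close> modulo \<open>n\<close>.\<close>
  define y where "y = x + int n * s"
  have Qy: "Q * y = u' + g" using s by (simp add: y_def B_def algebra_simps)
  \<comment> \<open>A form minus \<open>u\<close> and \<open>h\<close> is again a linear form, with
    coefficients at most \<open>2 * B\<close> and constant at most \<open>3 * B\<close>; this is the
    factor in \<open>sim_step\<close>.\<close>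
  have diff: "lin k c d e - u - h \<le> 0 \<longleftrightarrow> lin k c d e' - u' - h \<le> 0"
      "- (lin k c d e - u - h) \<le> 0 \<longleftrightarrow> - (lin k c d e' - u' - h) \<le> 0"
    if "small (c, d)" "\<bar>h\<bar> \<le> B" for c d h
  proof -
    have 1: "\<bar>c i - c0 i\<bar> \<le> int (sim_step n)" if "i < k" for i
    proof -
      have "\<bar>c i\<bar> \<le> B" "\<bar>c0 i\<bar> \<le> B" using that u \<open>small (c, d)\<close> by (auto simp: small_def)
      then show ?thesis unfolding step using B by linarith
    qed
    have 2: "\<bar>d - d0 - h\<bar> \<le> int (sim_step n)"
      using that u unfolding step small_def by (auto simp: abs_le_iff)
    show "lin k c d e - u - h \<le> 0 \<longleftrightarrow> lin k c d e' - u' - h \<le> 0"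
      unfolding u_def u'_def lin_diff using 1 2 by (rule sim_sign[OF sim])
    have "-1 * (lin k c d e - u - h) \<le> 0 \<longleftrightarrow> -1 * (lin k c d e' - u' - h) \<le> 0"
      unfolding u_def u'_def lin_diff lin_scale using 1 2
      by (intro sim_sign[OF sim]) (auto simp: abs_minus_commute)
    then show "- (lin k c d e - u - h) \<le> 0 \<longleftrightarrow> - (lin k c d e' - u' - h) \<le> 0" by simp
  qed
  have lower': "lin k c d e \<le> Q * x \<longleftrightarrow> lin k c d e' \<le> Q * y" if "small (c, d)" for c d
    using lower[OF that] diff(1)[OF that g] unfolding Qy by linarith
  have upper': "Q * x \<le> lin k c d e \<longleftrightarrow> Q * y \<le> lin k c d e'" if "small (c, d)" for c d
    using upper[OF that] diff(2)[OF that g] unfolding Qy by linarith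
  have "lin (Suc k) c d (case_nat x e) \<le> 0 \<longleftrightarrow> lin (Suc k) c d (case_nat y e') \<le> 0"
    if c: "\<And>i. i < Suc k \<Longrightarrow> \<bar>c i\<bar> \<le> int n" and d: "\<bar>d\<bar> \<le> int n" for c d
  proof -
    define c' where "c' = (\<lambda>i. c (Suc i))"
    have c': "\<bar>c' i\<bar> \<le> int n" if "i < k" for i using c that by (simp add: c'_def)
    \<comment> \<open>The multiplier \<open>q\<close> is \<open>Q\<close> divided by the absolute
      value of \<open>c 0\<close>. It is at most \<open>Q\<close>, which keeps the scaled form
      small.\<close>
    have scaled: "\<exists>q>0. q * \<bar>c 0\<bar> = Q \<and> small (\<lambda>i. q * c' i, q * d) \<and> small (\<lambda>i. - q * c' i, - q * d)"
      if "c 0 \<noteq> 0"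
    proof -
      have "nat \<bar>c 0\<bar> dvd fact n"
        using that c[of 0] by (intro dvd_fact) auto
      then have "\<bar>c 0\<bar> dvd Q" unfolding Q_def
        by (metis abs_ge_zero int_nat_eq of_nat_dvd_iff of_nat_fact)
      then obtain q where q: "Q = \<bar>c 0\<bar> * q" by (rule dvdE)
      then have "0 < q" using Q by (simp add: zero_less_mult_iff)
      moreover have "q \<le> Q" using q \<open>0 < q\<close> that by (simp add: mult_le_cancel_right1)
      then have bound: "\<bar>q * a\<bar> \<le> B" if "\<bar>a\<bar> \<le> int n" for a
        using that \<open>0 < q\<close> unfolding abs_mult B_def by (intro mult_mono) auto
      have "small (\<lambda>i. q * c' i, q * d)" "small (\<lambda>i. - q * c' i, - q * d)"
        using bound[OF d] bound[OF c'] by (simp_all add: small_def)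
      ultimately show ?thesis using q by (intro exI[of _ q]) (simp add: mult.commute)
    qed
    consider "c 0 = 0" | "c 0 > 0" | "c 0 < 0" by linarith
    then show ?thesis
    proof cases
      case 1
      then show ?thesis unfolding lin_Suc using c' d nB B step
        by (simp flip: c'_def) (intro sim_sign[OF sim]; force)
    next
      case 2
      with scaled obtain q where q: "0 < q" "q * c 0 = Q" "small (\<lambda>i. - q * c' i, - q * d)" by auto
      have "c 0 * z + lin k c' d f \<le> 0 \<longleftrightarrow> Q * z \<le> - q * lin k c' d f" for z f
      proof -
        have "c 0 * z + lin k c' d f \<le> 0 \<longleftrightarrow> q * (c 0 * z + lin k c' d f) \<le> 0"
          using q(1) by (simp add: mult_le_0_iff)
        also have "q * (c 0 * z + lin k c' d f) = Q * z - (- q * lin k c' d f)"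
          using arg_cong[OF q(2), of "\<lambda>a. a * z"] by (simp add: algebra_simps)
        finally show ?thesis by (simp only: diff_le_0_iff_le)
      qed
      then show ?thesis unfolding lin_Suc using upper'[OF q(3)] by (simp only: lin_scale flip: c'_def)
    next
      case 3
      with scaled obtain q where q: "0 < q" "q * c 0 = - Q" "small (\<lambda>i. q * c' i, q * d)" by fastforce
      have "c 0 * z + lin k c' d f \<le> 0 \<longleftrightarrow> q * lin k c' d f \<le> Q * z" for z f
      proof -
        have "c 0 * z + lin k c' d f \<le> 0 \<longleftrightarrow> q * (c 0 * z + lin k c' d f) \<le> 0"
          using q(1) by (simp add: mult_le_0_iff)
        also have "q * (c 0 * z + lin k c' d f) = q * lin k c' d f - Q * z"
          using arg_cong[OF q(2), of "\<lambda>a. a * z"] by (simp add: algebra_simps)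
        finally show ?thesis by simp
      qed
      then show ?thesis unfolding lin_Suc using lower'[OF q(3)] by (simp only: lin_scale flip: c'_def)
    qed
  qed
  moreover have "int n dvd case_nat x e i - case_nat y e' i" if "i < Suc k" for i
  proof (cases i)
    case 0
    then show ?thesis by (simp add: y_def)
  next
    case (Suc j)
    have "int n dvd int (sim_step n)" using dvd_sim_step by simp
    moreover have "int (sim_step n) dvd e j - e' j" using Suc that by (intro sim_mod[OF sim]) simp
    ultimately show ?thesis unfolding Suc by (simp only: nat.case dvd_trans)
  qed
  ultimately show ?thesis unfolding sim_def by blast
qed

text \<open>\<open>W\<close> bounds all forms with coefficients up to \<open>n\<close> at
  \<open>e\<close>, so beyond it a nonzero leading coefficient alone decides the sign. Hence
  \<open>x\<close> can be moved by multiples of \<open>n\<close> to distance at most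
  \<open>n\<close> from the interval between \<open>- W\<close> and \<open>W\<close>. The
  environment is the same on both sides, so no \<open>sim_step\<close> is spent.\<close>

lemma sim_bounded_witness:
  assumes n: "0 < n"
  shows "\<exists>y. \<bar>y\<bar> \<le> int n * ((\<Sum>i<k. \<bar>e i\<bar>) + 2) \<and> sim (Suc k) n (case_nat x e) (case_nat y e)"
proof -
  define W where "W = int n * ((\<Sum>i<k. \<bar>e i\<bar>) + 1)"
  have W: "0 \<le> W" unfolding W_def by (intro mult_nonneg_nonneg add_nonneg_nonneg sum_nonneg) auto
  have lin: "\<bar>lin k c d e\<bar> \<le> W" if "\<And>i. i < k \<Longrightarrow> \<bar>c i\<bar> \<le> int n" "\<bar>d\<bar> \<le> int n" for c d
  proof -
    have "\<bar>\<Sum>i<k. c i * e i\<bar> \<le> (\<Sum>i<k. int n * \<bar>e i\<bar>)"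
      by (rule order_trans[OF sum_abs sum_mono]) (auto simp: abs_mult that(1) intro: mult_right_mono)
    then show ?thesis using that(2) unfolding lin_def W_def
      by (simp add: sum_distrib_left[symmetric] algebra_simps)
  qed
  have sim: "sim (Suc k) n (case_nat x e) (case_nat y e)"
    if xy: "int n dvd x - y" and "x > W \<and> y > W \<or> x < - W \<and> y < - W" for x y
  proof -
    have "lin (Suc k) c d (case_nat x e) \<le> 0 \<longleftrightarrow> lin (Suc k) c d (case_nat y e) \<le> 0"
      if c: "\<And>i. i < Suc k \<Longrightarrow> \<bar>c i\<bar> \<le> int n" and d: "\<bar>d\<bar> \<le> int n" for c d
    proof -
      have L: "\<bar>lin k (\<lambda>i. c (Suc i)) d e\<bar> \<le> W" using c d by (intro lin) auto
      have pos: "z \<le> a * z" if "1 \<le> a" "0 \<le> z" for a z :: int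
        using that by (simp add: mult_le_cancel_right1)
      have key: "c 0 * z + l \<le> 0 \<longleftrightarrow> (if c 0 = 0 then l \<le> 0 else (c 0 > 0) = (z < 0))"
        if "z > W \<or> z < - W" "\<bar>l\<bar> \<le> W" for z l
      proof -
        consider "c 0 = 0" | "c 0 \<ge> 1" "z > W" | "c 0 \<ge> 1" "z < - W" | "c 0 \<le> -1" "z > W" | "c 0 \<le> -1" "z < - W"
          using \<open>z > W \<or> z < - W\<close> by linarith
        then show ?thesis
        proof cases
          case 2
          then have "\<not> c 0 * z + l \<le> 0" using pos[of "c 0" z] that(2) W by linarith
          then show ?thesis using 2 W by simp
        next
          case 3
          then have "c 0 * z + l \<le> 0" using pos[of "c 0" "- z"] that(2) W unfolding mult_minus_right by linarith
          then show ?thesis using 3 W by simp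
        next
          case 4
          then have "c 0 * z + l \<le> 0" using pos[of "- c 0" z] that(2) W unfolding mult_minus_left by linarith
          then show ?thesis using 4 W by simp
        next
          case 5
          then have "\<not> c 0 * z + l \<le> 0" using pos[of "- c 0" "- z"] that(2) W unfolding minus_mult_minus by linarith
          then show ?thesis using 5 W by simp
        qed simp
      qed
      show ?thesis unfolding lin_Suc using that \<open>x > W \<and> y > W \<or> x < - W \<and> y < - W\<close> L W
        by (subst (1 2) key) auto
    qed
    then show ?thesis using xy unfolding sim_def by (auto split: nat.split)
  qed
  have refl: "sim (Suc k) n (case_nat x e) (case_nat x e)" by (simp add: sim_def)
  have bound: "int n * ((\<Sum>i<k. \<bar>e i\<bar>) + 2) = W + int n" by (simp add: W_def algebra_simps)
  consider "\<bar>x\<bar> \<le> W + int n" | "x > W + int n" | "- x > W + int n" by linarith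
  then show ?thesis
  proof cases
    case 1
    then show ?thesis using refl unfolding bound by blast
  next
    case 2
    \<comment> \<open>The least integer above \<open>W\<close> that is congruent to \<open>x\<close>
      modulo \<open>n\<close>.\<close>
    define y where "y = W + 1 + (x - W - 1) mod int n"
    have y: "W < y" "y \<le> W + int n" using n unfolding y_def
      by (smt (verit) pos_mod_bound pos_mod_sign of_nat_0_less_iff)+
    have "x - y = (x - W - 1) - (x - W - 1) mod int n" by (simp add: y_def)
    then have "int n dvd x - y" by (simp only: dvd_minus_mod)
    then show ?thesis unfolding bound using y W 2 by (intro exI[of _ y] conjI sim) auto
  next
    case 3
    define y where "y = - W - 1 - (- x - W - 1) mod int n"
    have y: "- W > y" "- y \<le> W + int n" using n unfolding y_def
      by (smt (verit) pos_mod_bound pos_mod_sign of_nat_0_less_iff)+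
    have "y - x = (- x - W - 1) - (- x - W - 1) mod int n" by (simp add: y_def)
    then have "int n dvd y - x" by (simp only: dvd_minus_mod)
    then have "int n dvd x - y" by (simp add: dvd_diff_commute)
    then show ?thesis unfolding bound using y W 3 by (intro exI[of _ y] conjI sim) auto
  qed
qed

section \<open>Norms, quantifier rank and the induction on formulas\<close>

primrec coeff :: "pterm \<Rightarrow> nat \<Rightarrow> int" where
  "coeff (Num c) i = 0"
| "coeff (Var n) i = (if i = n then 1 else 0)"
| "coeff (Add s t) i = coeff s i + coeff t i"
| "coeff (Scale c t) i = c * coeff t i"

primrec absolute :: "pterm \<Rightarrow> int" where
  "absolute (Num c) = c"
| "absolute (Var n) = 0"
| "absolute (Add s t) = absolute s + absolute t"
| "absolute (Scale c t) = c * absolute t"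

primrec term_norm :: "pterm \<Rightarrow> nat" where
  "term_norm (Num c) = nat \<bar>c\<bar>"
| "term_norm (Var n) = 1"
| "term_norm (Add s t) = term_norm s + term_norm t"
| "term_norm (Scale c t) = nat \<bar>c\<bar> * term_norm t"

text \<open>An atom is about the difference of its two terms, so their norms add; across atoms only
  the maximum counts.\<close>

primrec form_norm :: "pform \<Rightarrow> nat" where
  "form_norm (Eq s t) = term_norm s + term_norm t"
| "form_norm (Leq s t) = term_norm s + term_norm t"
| "form_norm (Neg p) = form_norm p"
| "form_norm (Conj p q) = max (form_norm p) (form_norm q)"
| "form_norm (Ex p) = form_norm p"

primrec rank :: "pform \<Rightarrow> nat" where
  "rank (Eq s t) = 0"
| "rank (Leq s t) = 0"
| "rank (Neg p) = rank p"
| "rank (Conj p q) = max (rank p) (rank q)"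
| "rank (Ex p) = Suc (rank p)"

lemma abs_coeff_le: "\<bar>coeff t i\<bar> \<le> int (term_norm t)"
  by (induction t) (auto simp: abs_mult intro: mult_left_mono order_trans[OF abs_triangle_ineq])

lemma abs_absolute_le: "\<bar>absolute t\<bar> \<le> int (term_norm t)"
  by (induction t) (auto simp: abs_mult intro: mult_left_mono order_trans[OF abs_triangle_ineq])

text \<open>Instead of tracking free variables, the environment is taken to vanish from
  \<open>k\<close> on, so that excess variables contribute nothing.\<close>

lemma tval_eq_lin: "(\<And>i. k \<le> i \<Longrightarrow> e i = 0) \<Longrightarrow> tval e t = lin k (coeff t) (absolute t) e"
proof (induction t)
  case (Var n)
  have "(\<Sum>i<k. (if i = n then 1 else 0) * e i) = (\<Sum>i<k. if i = n then e i else 0)"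
    by (intro sum.cong) auto
  then show ?case using Var by (cases "n < k") (auto simp: lin_def)
qed (simp_all add: lin_def sum.distrib sum_distrib_left algebra_simps)

lemma sim_tval:
  assumes "sim k n e e'" "term_norm s + term_norm t \<le> n"
    and "\<And>i. k \<le> i \<Longrightarrow> e i = 0" "\<And>i. k \<le> i \<Longrightarrow> e' i = 0"
  shows "tval e s \<le> tval e t \<longleftrightarrow> tval e' s \<le> tval e' t"
proof -
  have "tval f s \<le> tval f t \<longleftrightarrow> lin k (\<lambda>i. coeff s i - coeff t i) (absolute s - absolute t - 0) f \<le> 0"
    if "\<And>i. k \<le> i \<Longrightarrow> f i = 0" for f
    proof -
    have "tval f u = lin k (coeff u) (absolute u) f" for u by (rule tval_eq_lin) (rule that)
    then show ?thesis unfolding lin_diff[symmetric] by simp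
  qed
  moreover have "\<bar>coeff s i - coeff t i\<bar> \<le> int n" for i
    using abs_coeff_le[of s i] abs_coeff_le[of t i] assms(2) by linarith
  moreover have "\<bar>absolute s - absolute t - 0\<bar> \<le> int n"
    using abs_absolute_le[of s] abs_absolute_le[of t] assms(2) by linarith
  ultimately show ?thesis using assms(3,4) sim_sign[OF assms(1)] by simp
qed

lemma sim_step_iterate:
  assumes "0 < n" "r \<le> s"
  shows "0 < (sim_step ^^ r) n" "(sim_step ^^ r) n dvd (sim_step ^^ s) n"
proof -
  show "0 < (sim_step ^^ r) n" for r using assms(1) by (induction r) (auto intro: sim_step_pos)
  show "(sim_step ^^ r) n dvd (sim_step ^^ s) n"
    using assms(2) by (induction rule: dec_induct) (auto intro: dvd_trans dvd_sim_step)
qed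

text \<open>\<open>r\<close> counts the remaining rounds: a quantifier consumes one
  \<open>sim_step\<close> through \<open>sim_extend\<close>. With \<open>rank p \<le> r\<close>
  instead of equality, both parts of a conjunction can use the same \<open>r\<close>.\<close>

lemma sim_sat:
  assumes n: "0 < n"
  shows "sim k ((sim_step ^^ r) n) e e' \<Longrightarrow> form_norm p \<le> n \<Longrightarrow> rank p \<le> r \<Longrightarrow>
    (\<And>i. k \<le> i \<Longrightarrow> e i = 0) \<Longrightarrow> (\<And>i. k \<le> i \<Longrightarrow> e' i = 0) \<Longrightarrow> sat p e \<longleftrightarrow> sat p e'"
proof (induction p arbitrary: k r e e')
  case (Eq s t)
  have "sim k n e e'" using sim_dvd[OF Eq(1)] sim_step_iterate[OF n, of 0 r] sim_step_iterate[OF n, of r r]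
    by simp
  then have "tval e s \<le> tval e t \<longleftrightarrow> tval e' s \<le> tval e' t" if "term_norm s + term_norm t \<le> n" for s t
    by (rule sim_tval) (use that Eq.prems in blast)+
  from this[of s t] this[of t s] show ?case using Eq.prems(2) by auto
next
  case (Leq s t)
  have "sim k n e e'" using sim_dvd[OF Leq(1)] sim_step_iterate[OF n, of 0 r] sim_step_iterate[OF n, of r r]
    by simp
  then show ?case using Leq by (simp add: sim_tval)
next
  case (Neg p)
  then show ?case by (metis form_norm.simps(3) rank.simps(3) sat.simps(3))
next
  case (Conj p q)
  from Conj.prems have "sat p e \<longleftrightarrow> sat p e'" by (intro Conj.IH(1)) auto
  moreover from Conj.prems have "sat q e \<longleftrightarrow> sat q e'" by (intro Conj.IH(2)) auto
  ultimately show ?case by simp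
next
  case (Ex p)
  then obtain s where r: "r = Suc s" "rank p \<le> s" by (cases r) auto
  have "\<exists>y. sat p (case_nat y f')" if sim: "sim k ((sim_step ^^ r) n) f f'" and sat: "sat p (case_nat x f)"
    and f: "\<And>i. k \<le> i \<Longrightarrow> f i = 0" "\<And>i. k \<le> i \<Longrightarrow> f' i = 0" for f f' x
  proof -
    from sim_extend[OF sim_step_iterate(1)[OF n order_refl], of k s f f' x] sim
    obtain y where "sim (Suc k) ((sim_step ^^ s) n) (case_nat x f) (case_nat y f')" by (auto simp: r)
    from Ex.IH[OF this] have "sat p (case_nat x f) \<longleftrightarrow> sat p (case_nat y f')"
      using Ex.prems r f by (auto split: nat.split)
    with sat show ?thesis by blast
  qed
  from this[of e e'] this[of e' e] show ?case using Ex.prems by (auto intro: sim_sym)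
qed

lemma sat_bounded_witness:
  assumes n: "0 < n" and p: "form_norm p \<le> n" "rank p \<le> r"
    and e: "\<And>i. k \<le> i \<Longrightarrow> e i = 0" and sat: "sat p (case_nat x e)"
  shows "\<exists>y. \<bar>y\<bar> \<le> int ((sim_step ^^ r) n) * ((\<Sum>i<k. \<bar>e i\<bar>) + 2) \<and> sat p (case_nat y e)"
proof -
  obtain y where "\<bar>y\<bar> \<le> int ((sim_step ^^ r) n) * ((\<Sum>i<k. \<bar>e i\<bar>) + 2)"
    and sim: "sim (Suc k) ((sim_step ^^ r) n) (case_nat x e) (case_nat y e)"
    using sim_bounded_witness sim_step_iterate(1)[OF n order_refl] by blast
  moreover have "sat p (case_nat x e) \<longleftrightarrow> sat p (case_nat y e)"
    using e by (intro sim_sat[OF n sim p]) (auto split: nat.split)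
  ultimately show ?thesis using sat by blast
qed

section \<open>Computable functions\<close>

text \<open>
  The function depends on finitely many of the variables \<open>e 0, e 1, \<dots>\<close>, and every sufficiently
  long list of them serves as the argument list of a program. This avoids arities, and the closure
  properties can be used as introduction rules.
\<close>

definition computable :: "((nat \<Rightarrow> nat) \<Rightarrow> nat) \<Rightarrow> bool" where
  "computable f \<longleftrightarrow> (\<exists>K. \<forall>k\<ge>K. \<exists>r. \<forall>e. computes r (map e [0..<k]) (f e))"

definition computable_pred :: "((nat \<Rightarrow> nat) \<Rightarrow> bool) \<Rightarrow> bool" where
  "computable_pred P \<longleftrightarrow> computable (\<lambda>e. of_bool (P e))"

lemma computableE:
  assumes "computable f"
  obtains K where "\<forall>k\<ge>K. \<exists>r. \<forall>e. computes r (map e [0..<k]) (f e)"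
  using assms unfolding computable_def by blast

lemma computableI:
  "(\<And>k. K \<le> k \<Longrightarrow> \<exists>r. \<forall>e. computes r (map e [0..<k]) (f e)) \<Longrightarrow> computable f"
  unfolding computable_def by blast

lemma computable_var: "computable (\<lambda>e. e i)"
proof (rule computableI)
  fix k assume "Suc i \<le> k"
  then show "\<exists>r. \<forall>e. computes r (map e [0..<k]) (e i)"
    using computes.intros(3)[of i "map _ [0..<k]"] by (intro exI[of _ "Proj i"]) simp
qed

lemma computable_Suc:
  assumes "computable f"
  shows "computable (\<lambda>e. Suc (f e))"
proof -
  from assms obtain K where K: "\<forall>k\<ge>K. \<exists>r. \<forall>e. computes r (map e [0..<k]) (f e)"
    by (rule computableE)
  show ?thesis
  proof (rule computableI)
    fix k assume "K \<le> k"
    then obtain r where r: "\<And>e. computes r (map e [0..<k]) (f e)" using K by blast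
    have "computes (Comp Succ [r]) (map e [0..<k]) (Suc (f e))" for e
      by (rule computes.intros(4)[where ys = "[f e]"]) (auto intro: r computes.intros)
    then show "\<exists>r. \<forall>e. computes r (map e [0..<k]) (Suc (f e))" by blast
  qed
qed

lemma computable_const: "computable (\<lambda>e. c)"
proof (induction c)
  case 0
  show ?case by (rule computableI[of 0]) (blast intro: computes.intros)
next
  case (Suc c)
  then show ?case by (rule computable_Suc)
qed

text \<open>A program for \<open>f\<close> on the first \<open>n\<close> variables needs only
  \<open>n\<close> of the functions in \<open>h\<close>; the sum of their thresholds is a threshold
  for all of them.\<close>

lemma computable_subst:
  assumes f: "computable f" and h: "\<And>i. computable (\<lambda>e. h e i)"
  shows "computable (\<lambda>e. f (h e))"
proof -
  from f obtain n r where r: "\<And>e. computes r (map e [0..<n]) (f e)" by (meson computableE order_refl)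
  from h have "\<exists>K. \<forall>i k. K i \<le> k \<longrightarrow> (\<exists>r. \<forall>e. computes r (map e [0..<k]) (h e i))"
    unfolding computable_def by (intro choice allI) blast
  then obtain K where K: "\<And>i k. K i \<le> k \<Longrightarrow> \<exists>r. \<forall>e. computes r (map e [0..<k]) (h e i)" by blast
  show ?thesis
  proof (rule computableI)
    fix k assume k: "sum K {..<n} \<le> k"
    have "\<exists>r. \<forall>e. computes r (map e [0..<k]) (h e i)" if "i < n" for i
      using that k by (intro K order_trans[OF member_le_sum[of i "{..<n}" K] k]) auto
    then obtain s where s: "\<And>i e. i < n \<Longrightarrow> computes (s i) (map e [0..<k]) (h e i)" by metis
    have "computes (Comp r (map s [0..<n])) (map e [0..<k]) (f (h e))" for e
      using s by (intro computes.intros(4)[OF _ r]) (auto simp: list_all2_conv_all_nth)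
    then show "\<exists>r. \<forall>e. computes r (map e [0..<k]) (f (h e))" by blast
  qed
qed

lemma map_case_nat: "map (case_nat x e) [0..<Suc k] = x # map e [0..<k]"
  by (simp add: upt_conv_Cons map_Suc_upt[symmetric] del: upt_Suc)

text \<open>The counter and the previous value are variables 0 and 1 of the step, in the order in
  which \<open>PrimRec\<close> prepends them; outer variables are shifted by two.\<close>

lemma computable_rec:
  assumes n: "computable n" and b: "computable b"
    and g: "computable (\<lambda>e. g (e 0) (e 1) (\<lambda>i. e (Suc (Suc i))))"
  shows "computable (\<lambda>e. rec_nat (b e) (\<lambda>m y. g m y e) (n e))"
proof -
  from n obtain K1 where K1: "\<forall>k\<ge>K1. \<exists>r. \<forall>e. computes r (map e [0..<k]) (n e)"
    by (rule computableE)
  from b obtain K2 where K2: "\<forall>k\<ge>K2. \<exists>r. \<forall>e. computes r (map e [0..<k]) (b e)"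
    by (rule computableE)
  from g obtain K3 where K3: "\<forall>k\<ge>K3. \<exists>r. \<forall>e. computes r (map e [0..<k])
      (g (e 0) (e 1) (\<lambda>i. e (Suc (Suc i))))"
    by (rule computableE)
  show ?thesis
  proof (rule computableI)
    fix k assume k: "K1 + K2 + K3 \<le> k"
    obtain rn where rn: "\<And>e. computes rn (map e [0..<k]) (n e)" using K1 k by (meson add_leE)
    obtain rb where rb: "\<And>e. computes rb (map e [0..<k]) (b e)" using K2 k by (meson add_leE)
    have "K3 \<le> Suc (Suc k)" using k by simp
    then obtain rg where rg: "\<And>e. computes rg (map e [0..<Suc (Suc k)]) (g (e 0) (e 1) (\<lambda>i. e (Suc (Suc i))))"
      using K3 by blast
    have step: "computes rg (m # y # map e [0..<k]) (g m y e)" for m y e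
      using rg[of "case_nat m (case_nat y e)"] unfolding map_case_nat by simp
    have rec: "computes (PrimRec rb rg) (m # map e [0..<k]) (rec_nat (b e) (\<lambda>m y. g m y e) m)" for m e
      by (induction m) (auto intro: computes.intros rb step)
    have args: "list_all2 (\<lambda>g. computes g (map e [0..<k])) (rn # map Proj [0..<k]) (n e # map e [0..<k])" for e
      using rn computes.intros(3)[of _ "map e [0..<k]"]
      unfolding list.rel_inject by (simp add: list_all2_conv_all_nth)
    show "\<exists>r. \<forall>e. computes r (map e [0..<k]) (rec_nat (b e) (\<lambda>m y. g m y e) (n e))"
      using computes.intros(4)[OF args rec] by blast
  qed
qed

text \<open>\<open>Mu\<close> stops at the first value 0, hence the negated predicate.\<close>

lemma computes_Least:
  assumes r: "\<And>n. computes r (n # xs) (of_bool (\<not> P n))" and ex: "\<exists>n. P n"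
  shows "computes (Mu r) xs (LEAST n. P n)"
proof (rule computes.intros(7))
  show "computes r ((LEAST n. P n) # xs) 0"
    using r[of "LEAST n. P n"] LeastI_ex[OF ex] by simp
  show "\<exists>y. computes r (m # xs) (Suc y)" if "m < (LEAST n. P n)" for m
    using r[of m] not_less_Least[OF that] by (intro exI[of _ 0]) simp
qed

text \<open>Reindexing carries an outer function under a binder, where its variables are
  shifted.\<close>

lemma computable_vars: "computable f \<Longrightarrow> computable (\<lambda>e. f (\<lambda>i. e (s i)))"
  using computable_subst[of f "\<lambda>e i. e (s i)"] computable_var by blast

lemma computable_pred_vars: "computable_pred P \<Longrightarrow> computable_pred (\<lambda>e. P (\<lambda>i. e (s i)))"
  unfolding computable_pred_def by (rule computable_vars)

lemma computable_of_bool: "computable_pred P \<Longrightarrow> computable (\<lambda>e. of_bool (P e))"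
  by (simp add: computable_pred_def)

lemma computable_if:
  assumes "computable_pred P" "computable f" "computable g"
  shows "computable (\<lambda>e. if P e then f e else g e)"
proof -
  have "computable (\<lambda>e. rec_nat (g e) (\<lambda>m y. f e) (of_bool (P e)))"
    using assms(1) by (intro computable_rec computable_of_bool assms(2,3) computable_vars[OF assms(2)])
  moreover have "rec_nat b (\<lambda>m y. a) (of_bool Q) = (if Q then a else b)" for a b :: nat and Q
    by simp
  ultimately show ?thesis by simp
qed

lemma computable_predI:
  "computable f \<Longrightarrow> (\<And>e. of_bool (P e) = f e) \<Longrightarrow> computable_pred P"
  by (simp add: computable_pred_def)

lemma computable_not: "computable_pred P \<Longrightarrow> computable_pred (\<lambda>e. \<not> P e)"
  by (rule computable_predI[of "\<lambda>e. if P e then 0 else 1"]) (auto intro: computable_if computable_const)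

lemma computable_and: "computable_pred P \<Longrightarrow> computable_pred Q \<Longrightarrow> computable_pred (\<lambda>e. P e \<and> Q e)"
  by (rule computable_predI[of "\<lambda>e. if P e then of_bool (Q e) else 0"])
    (auto intro: computable_if computable_of_bool computable_const)

lemma computable_or: "computable_pred P \<Longrightarrow> computable_pred Q \<Longrightarrow> computable_pred (\<lambda>e. P e \<or> Q e)"
  using computable_not[OF computable_and[OF computable_not computable_not]] by simp

lemma computable_imp: "computable_pred P \<Longrightarrow> computable_pred Q \<Longrightarrow> computable_pred (\<lambda>e. P e \<longrightarrow> Q e)"
  unfolding imp_conv_disj by (intro computable_or computable_not)

lemma computable_add:
  assumes "computable f" "computable g"
  shows "computable (\<lambda>e. f e + g e)"
proof -
  have "computable (\<lambda>e. rec_nat (g e) (\<lambda>m y. Suc y) (f e))"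
    using assms by (intro computable_rec computable_Suc computable_var)
  moreover have "rec_nat b (\<lambda>m y. Suc y) a = a + b" for a b by (induction a) auto
  ultimately show ?thesis by simp
qed

lemma computable_mult:
  assumes "computable f" "computable g"
  shows "computable (\<lambda>e. f e * g e)"
proof -
  have "computable (\<lambda>e. rec_nat 0 (\<lambda>m y. g e + y) (f e))"
    by (intro computable_rec computable_add assms assms(2)[THEN computable_vars] computable_var computable_const)
  moreover have "rec_nat 0 (\<lambda>m y. b + y) a = a * b" for a b :: nat by (induction a) auto
  ultimately show ?thesis by simp
qed

lemma computable_diff:
  assumes "computable f" "computable g"
  shows "computable (\<lambda>e. f e - g e)"
proof -
  have pred: "computable (\<lambda>e. f e - 1)" if "computable f" for f
  proof -
    have "computable (\<lambda>e. rec_nat 0 (\<lambda>m y. m) (f e))"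
      using that by (intro computable_rec computable_const computable_var)
    moreover have "rec_nat 0 (\<lambda>m y. m) a = a - 1" for a :: nat by (cases a) auto
    ultimately show ?thesis by simp
  qed
  have "computable (\<lambda>e. rec_nat (f e) (\<lambda>m y. y - 1) (g e))"
    using assms by (intro computable_rec pred computable_var)
  moreover have "rec_nat a (\<lambda>m y. y - 1) b = a - b" for a b :: nat by (induction b) auto
  ultimately show ?thesis by simp
qed

lemma computable_le: "computable f \<Longrightarrow> computable g \<Longrightarrow> computable_pred (\<lambda>e. f e \<le> g e)"
  by (rule computable_predI[of "\<lambda>e. 1 - (f e - g e)"]) (auto intro: computable_diff computable_const)

lemma computable_less: "computable f \<Longrightarrow> computable g \<Longrightarrow> computable_pred (\<lambda>e. f e < g e)"
  using computable_not[OF computable_le, of g f] by (simp add: not_le)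

lemma computable_eq: "computable f \<Longrightarrow> computable g \<Longrightarrow> computable_pred (\<lambda>e. f e = g e)"
  unfolding order.eq_iff by (intro computable_and computable_le)

lemma computable_pred_ex_less:
  assumes "computable n" "computable_pred (\<lambda>e. P (e 0) (\<lambda>i. e (Suc i)))"
  shows "computable_pred (\<lambda>e. \<exists>x<n e. P x e)"
proof -
  have "computable_pred (\<lambda>e. P (e 0) (\<lambda>i. e (Suc (Suc i))))"
    using computable_pred_vars[OF assms(2), of "case_nat 0 (\<lambda>i. Suc (Suc i))"] by simp
  then have "computable (\<lambda>e. rec_nat 0 (\<lambda>m y. if P m e then 1 else y) (n e))"
    by (intro computable_rec assms(1) computable_if computable_const computable_var)
  moreover have "rec_nat 0 (\<lambda>m y. if P m e then 1 else y) k = (of_bool (\<exists>x<k. P x e) :: nat)" for k e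
    by (induction k) (auto simp: less_Suc_eq)
  ultimately show ?thesis by (simp add: computable_pred_def)
qed

lemma computable_pred_ex:
  assumes "computable n" "\<And>e x. P x e \<Longrightarrow> x \<le> n e" "computable_pred (\<lambda>e. P (e 0) (\<lambda>i. e (Suc i)))"
  shows "computable_pred (\<lambda>e. \<exists>x. P x e)"
proof -
  have "computable_pred (\<lambda>e. \<exists>x<Suc (n e). P x e)"
    by (intro computable_pred_ex_less computable_Suc assms(1,3))
  moreover have "(\<exists>x<Suc (n e). P x e) \<longleftrightarrow> (\<exists>x. P x e)" for e
    using assms(2) by (auto simp: less_Suc_eq_le)
  ultimately show ?thesis by simp
qed

lemma computable_pred_all_less:
  assumes "computable n" "computable_pred (\<lambda>e. P (e 0) (\<lambda>i. e (Suc i)))"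
  shows "computable_pred (\<lambda>e. \<forall>x<n e. P x e)"
  using computable_not[OF computable_pred_ex_less[OF assms(1) computable_not[OF assms(2)]]] by simp

lemma computable_Least:
  assumes P: "computable_pred (\<lambda>e. P (e 0) (\<lambda>i. e (Suc i)))" and ex: "\<And>e. \<exists>x. P x e"
  shows "computable (\<lambda>e. LEAST x. P x e)"
proof -
  from computable_not[OF P] obtain K where K: "\<forall>k\<ge>K.
      \<exists>r. \<forall>e. computes r (map e [0..<k]) (of_bool (\<not> P (e 0) (\<lambda>i. e (Suc i))))"
    unfolding computable_pred_def by (rule computableE)
  show ?thesis
  proof (rule computableI)
    fix k assume "K \<le> k"
    then have "K \<le> Suc k" by simp
    then obtain r where r: "\<And>e. computes r (map e [0..<Suc k]) (of_bool (\<not> P (e 0) (\<lambda>i. e (Suc i))))"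
      using K by blast
    have "computes r (n # map e [0..<k]) (of_bool (\<not> P n e))" for n e
      using r[of "case_nat n e"] unfolding map_case_nat by simp
    then show "\<exists>r. \<forall>e. computes r (map e [0..<k]) (LEAST x. P x e)"
      using computes_Least[OF _ ex] by blast
  qed
qed

section \<open>Division, powers, and codes of pairs, lists and integers\<close>

lemmas computable_arith = computable_var computable_const computable_Suc computable_add
  computable_mult computable_diff computable_if computable_of_bool computable_not computable_and
  computable_or computable_imp computable_le computable_less computable_eq

lemma computable_div:
  assumes "computable f" "computable g"
  shows "computable (\<lambda>e. f e div g e)"
proof -
  \<comment> \<open>The first disjunct stops the search at 0 when the divisor is 0, in accordance
    with \<open>a div 0 = 0\<close>.\<close>
  have "computable (\<lambda>e. LEAST q. g e = 0 \<or> f e < g e * Suc q)"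
  proof (rule computable_Least)
    show "computable_pred (\<lambda>e. g (\<lambda>i. e (Suc i)) = 0 \<or> f (\<lambda>i. e (Suc i)) < g (\<lambda>i. e (Suc i)) * Suc (e 0))"
      by (intro computable_arith assms[THEN computable_vars])
    show "\<exists>q. g e = 0 \<or> f e < g e * Suc q" for e
      using dividend_less_times_div[of "g e" "f e"] by (cases "g e = 0") (auto intro: exI[of _ "f e div g e"])
  qed
  moreover have "(LEAST q. b = 0 \<or> a < b * Suc q) = a div b" for a b :: nat
  proof (rule Least_equality)
    show "b = 0 \<or> a < b * Suc (a div b)" using dividend_less_times_div[of b a] by auto
    show "a div b \<le> q" if "b = 0 \<or> a < b * Suc q" for q
      using that by (cases "b = 0") (auto simp: less_mult_imp_div_less mult.commute less_Suc_eq_le[symmetric])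
  qed
  ultimately show ?thesis by simp
qed

lemma computable_power: "computable f \<Longrightarrow> computable g \<Longrightarrow> computable (\<lambda>e. f e ^ g e)"
proof -
  assume *: "computable f" "computable g"
  have "computable (\<lambda>e. rec_nat 1 (\<lambda>m y. f e * y) (g e))"
    by (intro computable_rec computable_arith * *[THEN computable_vars])
  moreover have "rec_nat 1 (\<lambda>m y. a * y) b = a ^ b" for a b :: nat by (induction b) auto
  ultimately show ?thesis by simp
qed

lemma computable_fact: "computable f \<Longrightarrow> computable (\<lambda>e. fact (f e))"
proof -
  assume *: "computable f"
  have "computable (\<lambda>e. rec_nat 1 (\<lambda>m y. Suc m * y) (f e))"
    by (intro computable_rec computable_arith * *[THEN computable_vars])
  moreover have "rec_nat 1 (\<lambda>m y. Suc m * y) a = fact a" for a :: nat by (induction a) auto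
  ultimately show ?thesis by simp
qed

lemma computable_even: "computable f \<Longrightarrow> computable_pred (\<lambda>e. even (f e))"
proof -
  assume "computable f"
  then have "computable_pred (\<lambda>e. f e = 2 * (f e div 2))"
    by (intro computable_arith computable_div)
  moreover have "n = 2 * (n div 2) \<longleftrightarrow> even n" for n :: nat by presburger
  ultimately show ?thesis by simp
qed

lemma computable_set_decode:
  "computable f \<Longrightarrow> computable g \<Longrightarrow> computable_pred (\<lambda>e. f e \<in> set_decode (g e))"
  unfolding set_decode_def mem_Collect_eq
  by (intro computable_not computable_even computable_div computable_power computable_const)

lemma computable_prod_encode:
  assumes "computable f" "computable g"
  shows "computable (\<lambda>e. prod_encode (f e, g e))"
proof -
  have "prod_encode (a, b) = ((a + b) * Suc (a + b)) div 2 + a" for a b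
    by (simp add: prod_encode_def triangle_def)
  then show ?thesis by (simp only:) (intro computable_arith computable_div assms)
qed

text \<open>Decoding is search through the encoding; the other component is bounded by the
  code.\<close>

lemma computable_snd_prod_decode:
  assumes "computable f"
  shows "computable (\<lambda>e. snd (prod_decode (f e)))"
proof -
  have "computable (\<lambda>e. LEAST b. \<exists>a. prod_encode (a, b) = f e)"
  proof (rule computable_Least)
    show "computable_pred (\<lambda>e. \<exists>a. prod_encode (a, e 0) = f (\<lambda>i. e (Suc i)))"
      by (intro computable_pred_ex[where n = "\<lambda>e. f (\<lambda>i. e (Suc i))"] computable_prod_encode
          computable_arith assms[THEN computable_vars]) (metis le_prod_encode_1)
    show "\<exists>b a. prod_encode (a, b) = f e" for e by (metis prod.collapse prod_decode_inverse)
  qed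
  moreover have "(LEAST b. \<exists>a. prod_encode (a, b) = z) = snd (prod_decode z)" for z
    by (rule Least_equality) (metis prod.collapse prod_decode_inverse, metis eq_refl prod_encode_inverse snd_conv)
  ultimately show ?thesis by simp
qed

lemma computable_fst_prod_decode:
  assumes "computable f"
  shows "computable (\<lambda>e. fst (prod_decode (f e)))"
proof -
  have "computable (\<lambda>e. LEAST a. prod_encode (a, snd (prod_decode (f e))) = f e)"
  proof (rule computable_Least)
    show "computable_pred (\<lambda>e. prod_encode (e 0, snd (prod_decode (f (\<lambda>i. e (Suc i))))) = f (\<lambda>i. e (Suc i)))"
      by (intro computable_prod_encode computable_snd_prod_decode computable_arith assms[THEN computable_vars])
    show "\<exists>a. prod_encode (a, snd (prod_decode (f e))) = f e" for e
      by (metis prod.collapse prod_decode_inverse)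
  qed
  moreover have "(LEAST a. prod_encode (a, snd (prod_decode z)) = z) = fst (prod_decode z)" for z
    by (rule Least_equality) (simp, metis eq_refl prod_encode_inverse fst_conv)
  ultimately show ?thesis by simp
qed

text \<open>A nonempty list is coded by the successor of a pair, so subtracting 1 and projecting
  gives the tail. Truncated subtraction fixes the code 0 of the empty list; hence positions past the
  end read as 0.\<close>

definition drop_code :: "nat \<Rightarrow> nat \<Rightarrow> nat" where
  "drop_code i v = ((\<lambda>y. snd (prod_decode (y - 1))) ^^ i) v"

definition nth_code :: "nat \<Rightarrow> nat \<Rightarrow> nat" where
  "nth_code v i = fst (prod_decode (drop_code i v - 1))"

lemma prod_decode_0: "prod_decode 0 = (0, 0)"
  using prod_encode_inverse[of "(0, 0)"] by (simp add: prod_encode_def)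

lemma drop_code_list_encode: "drop_code i (list_encode xs) = list_encode (drop i xs)"
proof (induction i)
  case (Suc i)
  then show ?case unfolding drop_code_def
    by (cases "drop i xs") (auto simp: prod_decode_0 drop_Suc tl_drop[symmetric])
qed (simp add: drop_code_def)

lemma nth_code_list_encode: "nth_code (list_encode xs) i = (if i < length xs then xs ! i else 0)"
proof (cases "i < length xs")
  case True
  then show ?thesis by (simp add: nth_code_def drop_code_list_encode flip: Cons_nth_drop_Suc)
qed (simp add: nth_code_def drop_code_list_encode prod_decode_0)

lemma drop_code_eq_0: "drop_code i (list_encode xs) = 0 \<longleftrightarrow> length xs \<le> i"
  proof -
  have "list_encode ys = 0 \<longleftrightarrow> ys = []" for ys by (cases ys) auto
  then show ?thesis by (simp add: drop_code_list_encode)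
qed

lemma length_le_list_encode: "length xs \<le> list_encode xs"
  by (induction xs) (auto intro: order_trans[OF _ le_prod_encode_2])

lemma nth_code_le: "nth_code v i \<le> v"
proof -
  have 1: "snd (prod_decode (y - 1)) \<le> y" "fst (prod_decode (y - 1)) \<le> y" for y
    using le_prod_encode_2[of "snd (prod_decode (y - 1))" "fst (prod_decode (y - 1))"]
      le_prod_encode_1[of "fst (prod_decode (y - 1))" "snd (prod_decode (y - 1))"] by simp_all
  have "drop_code i v \<le> v" unfolding drop_code_def
    by (induction i) (auto intro: order_trans[OF 1(1)[unfolded One_nat_def]])
  then show ?thesis unfolding nth_code_def by (rule order_trans[OF 1(2)])
qed

lemma computable_drop_code: "computable f \<Longrightarrow> computable g \<Longrightarrow> computable (\<lambda>e. drop_code (f e) (g e))"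
proof -
  assume *: "computable f" "computable g"
  have "computable (\<lambda>e. rec_nat (g e) (\<lambda>m y. snd (prod_decode (y - 1))) (f e))"
    using * by (intro computable_rec computable_snd_prod_decode computable_arith)
  moreover have "rec_nat v (\<lambda>m y. snd (prod_decode (y - 1))) i = drop_code i v" for v i
    by (induction i) (auto simp: drop_code_def)
  ultimately show ?thesis by simp
qed

lemma computable_nth_code: "computable f \<Longrightarrow> computable g \<Longrightarrow> computable (\<lambda>e. nth_code (f e) (g e))"
  unfolding nth_code_def by (intro computable_fst_prod_decode computable_drop_code computable_arith)

text \<open>Even codes stand for the nonnegative integers, odd ones for the negative. As a
  difference of two naturals, an integer can be handled by arithmetic on \<open>nat\<close>.\<close>

definition pos_part :: "nat \<Rightarrow> nat" where "pos_part n = (if even n then n div 2 else 0)"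
definition neg_part :: "nat \<Rightarrow> nat" where "neg_part n = (if even n then 0 else Suc (n div 2))"

lemma int_decode_parts: "int_decode n = int (pos_part n) - int (neg_part n)"
  by (simp add: int_decode_def sum_decode_def pos_part_def neg_part_def)

text \<open>At most one of the truncated differences is nonzero, which replaces a case distinction
  on the sign.\<close>

lemma int_encode_diff: "int_encode (int p - int n) = 2 * (p - n) + (2 * (n - p) - 1)"
  by (cases "n \<le> p") (auto simp: int_encode_def sum_encode_def nat_diff_distrib' algebra_simps)

lemma computable_parts:
  "computable f \<Longrightarrow> computable (\<lambda>e. pos_part (f e))" "computable f \<Longrightarrow> computable (\<lambda>e. neg_part (f e))"
  unfolding pos_part_def neg_part_def by (intro computable_arith computable_even computable_div; assumption)+

lemma computable_int_add:
  assumes "computable f" "computable g"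
  shows "computable (\<lambda>e. int_encode (int_decode (f e) + int_decode (g e)))"
proof -
  have "int_decode x + int_decode y = int (pos_part x + pos_part y) - int (neg_part x + neg_part y)" for x y
    by (simp add: int_decode_parts)
  then show ?thesis
    by (simp only: int_encode_diff) (intro computable_arith computable_parts assms)
qed

lemma computable_int_mult:
  assumes "computable f" "computable g"
  shows "computable (\<lambda>e. int_encode (int_decode (f e) * int_decode (g e)))"
proof -
  have "int_decode x * int_decode y = int (pos_part x * pos_part y + neg_part x * neg_part y)
      - int (pos_part x * neg_part y + neg_part x * pos_part y)" for x y
    by (simp add: int_decode_parts algebra_simps)
  then show ?thesis
    by (simp only: int_encode_diff) (intro computable_arith computable_parts assms)
qed

lemma computable_int_le:
  assumes "computable f" "computable g"
  shows "computable_pred (\<lambda>e. int_decode (f e) \<le> int_decode (g e))"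
proof -
  have "int_decode x \<le> int_decode y \<longleftrightarrow> pos_part x + neg_part y \<le> pos_part y + neg_part x" for x y
    by (simp add: int_decode_parts) linarith
  then show ?thesis by (simp only:) (intro computable_arith computable_parts assms)
qed

lemmas computable_intros = computable_arith computable_div computable_power computable_fact
  computable_even computable_set_decode computable_prod_encode computable_drop_code
  computable_nth_code computable_int_add computable_int_mult computable_int_le
  computable_pred_ex_less computable_pred_all_less

text \<open>A program obtained from \<open>computable\<close> expects a list of some unknown length;
  positions after the two real arguments are filled with zeros.\<close>

lemma computable_binary:
  assumes "computable (\<lambda>e. f (e 0) (e 1))"
  shows "\<exists>r. \<forall>a b. computes r [a, b] (f a b)"
proof -
  from assms obtain r k where r: "\<And>e. computes r (map e [0..<k]) (f (e 0) (e 1))"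
    by (meson computableE order_refl)
  have "computes (Comp r (map (\<lambda>i. if i < 2 then Proj i else Zero) [0..<k])) [a, b] (f a b)" for a b
  proof (rule computes.intros(4))
    let ?e = "\<lambda>i. if i = 0 then a else if i = 1 then b else 0"
    show "computes r (map ?e [0..<k]) (f a b)" using r[of ?e] by simp
    show "list_all2 (\<lambda>g. computes g [a, b]) (map (\<lambda>i. if i < 2 then Proj i else Zero) [0..<k]) (map ?e [0..<k])"
      using computes.intros(3)[of 0 "[a, b]"] computes.intros(3)[of 1 "[a, b]"]
      by (auto simp: list_all2_conv_all_nth less_2_cases_iff intro: computes.intros)
  qed
  then show ?thesis by blast
qed

text \<open>Unlike in \<open>computable_Least\<close>, a solution is required only for the input at
  hand: a number that codes no description may have no certificate.\<close>

lemma computable_search: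
  assumes P: "computable_pred (\<lambda>e. P (e 0) (e 1))" and f: "computable (\<lambda>e. f (e 0) (e 1))"
  shows "\<exists>r. \<forall>x. (\<exists>t. P t x) \<longrightarrow> computes r [x] (f (LEAST t. P t x) x)"
proof -
  obtain rP where rP: "\<And>t x. computes rP [t, x] (of_bool (\<not> P t x))"
    using computable_binary[OF computable_not[OF P, unfolded computable_pred_def]] by blast
  obtain rf where rf: "\<And>t x. computes rf [t, x] (f t x)" using computable_binary[OF f] by blast
  have "computes (Comp rf [Mu rP, Proj 0]) [x] (f (LEAST t. P t x) x)" if "\<exists>t. P t x" for x
    using computes.intros(3)[of 0 "[x]"]
    by (intro computes.intros(4)[OF _ rf]) (simp add: computes_Least[OF rP that])
  then show ?thesis by blast
qed

section \<open>Certificates for the truth of Presburger formulas\<close>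

text \<open>Every number codes a list and hence an environment. Entries past the end decode to 0, so
  0 codes the zero environment.\<close>

definition env_code :: "nat \<Rightarrow> nat \<Rightarrow> int" where
  "env_code v i = int_decode (nth_code v i)"

definition cons_code :: "nat \<Rightarrow> nat \<Rightarrow> nat" where
  "cons_code x v = Suc (prod_encode (x, v))"

definition term_fact :: "nat \<Rightarrow> nat \<Rightarrow> nat \<Rightarrow> nat" where
  "term_fact c v w = prod_encode (0, prod_encode (c, prod_encode (v, w)))"

definition form_fact :: "nat \<Rightarrow> nat \<Rightarrow> nat \<Rightarrow> nat" where
  "form_fact c v b = prod_encode (1, prod_encode (c, prod_encode (v, b)))"

text \<open>Derived from \<open>sat_bounded_witness\<close>: the absolute values in the environment
  sum to at most its code \<open>v\<close>, \<open>int_encode\<close> at most doubles an absolute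
  value, and \<open>Suc\<close> makes the bound strict.\<close>

definition search_range :: "nat \<Rightarrow> nat \<Rightarrow> nat" where
  "search_range M v = Suc (2 * M * (v + 2))"

text \<open>
  The fact \<open>term_fact c v w\<close> stands for "the term coded by \<open>c\<close> has the value coded by \<open>w\<close> in the
  environment coded by \<open>v\<close>", and \<open>form_fact c v b\<close> for "the formula coded by \<open>c\<close> has the truth value
  \<open>b\<close> there". The number \<open>M\<close> bounds the search for witnesses: it matters only in the last rule.
\<close>

inductive justified :: "nat \<Rightarrow> nat set \<Rightarrow> nat \<Rightarrow> bool" for M A where
  Num: "justified M A (term_fact (prod_encode (0, a)) v a)"
| Var: "justified M A (term_fact (prod_encode (1, n)) v (nth_code v n))"
| Add: "term_fact a v x \<in> A \<Longrightarrow> term_fact b v y \<in> A \<Longrightarrow>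
    justified M A (term_fact (prod_encode (2, prod_encode (a, b))) v
      (int_encode (int_decode x + int_decode y)))"
| Scale: "term_fact b v y \<in> A \<Longrightarrow>
    justified M A (term_fact (prod_encode (3, prod_encode (a, b))) v
      (int_encode (int_decode a * int_decode y)))"
| Eq: "term_fact a v x \<in> A \<Longrightarrow> term_fact b v y \<in> A \<Longrightarrow>
    justified M A (form_fact (prod_encode (0, prod_encode (a, b))) v (of_bool (x = y)))"
| Leq: "term_fact a v x \<in> A \<Longrightarrow> term_fact b v y \<in> A \<Longrightarrow>
    justified M A (form_fact (prod_encode (1, prod_encode (a, b))) v
      (of_bool (int_decode x \<le> int_decode y)))"
| Neg: "form_fact a v x \<in> A \<Longrightarrow> justified M A (form_fact (prod_encode (2, a)) v (1 - x))"
| Conj: "form_fact a v x \<in> A \<Longrightarrow> form_fact b v y \<in> A \<Longrightarrow>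
    justified M A (form_fact (prod_encode (3, prod_encode (a, b))) v (x * y))"
| Ex: "form_fact a (cons_code x v) 1 \<in> A \<Longrightarrow> justified M A (form_fact (prod_encode (4, a)) v 1)"
| Not_Ex: "(\<forall>x<search_range M v. form_fact a (cons_code x v) 0 \<in> A) \<Longrightarrow>
    justified M A (form_fact (prod_encode (4, a)) v 0)"

text \<open>For codes of terms and formulas each rule appeals only to facts on immediate parts. So
  soundness goes by structural induction, and no order among the facts has to be stored.\<close>

definition certificate :: "nat \<Rightarrow> nat set \<Rightarrow> bool" where
  "certificate M A \<longleftrightarrow> finite A \<and> (\<forall>x\<in>A. justified M A x)"

lemma fact_eq [simp]:
  "term_fact c v w = term_fact c' v' w' \<longleftrightarrow> c = c' \<and> v = v' \<and> w = w'"
  "form_fact c v w = form_fact c' v' w' \<longleftrightarrow> c = c' \<and> v = v' \<and> w = w'"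
  "term_fact c v w \<noteq> form_fact c' v' w'" "form_fact c v w \<noteq> term_fact c' v' w'"
  by (simp_all add: term_fact_def form_fact_def)

lemma env_code_cons: "env_code (cons_code x v) = case_nat (int_decode x) (env_code v)"
proof -
  have "nth_code (cons_code x v) i = case_nat x (nth_code v) i" for i
    using nth_code_list_encode[of "x # list_decode v" i] nth_code_list_encode[of "list_decode v"]
    by (simp add: cons_code_def split: nat.split)
  then show ?thesis by (auto simp: env_code_def fun_eq_iff split: nat.split)
qed

lemma env_code_0: "env_code 0 = (\<lambda>_. 0)"
  using nth_code_list_encode[of "[]"]
  by (simp add: env_code_def int_decode_def sum_decode_def fun_eq_iff)

text \<open>The tags in the codes leave a single rule for each constructor, so inverting
  \<open>justified\<close> yields facts on the subterms.\<close>

lemma certificate_term_sound: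
  assumes "certificate M A"
  shows "term_fact (code_pterm t) v w \<in> A \<Longrightarrow> w = int_encode (tval (env_code v) t)"
proof (induction t arbitrary: w)
  case (Num c)
  then have "justified M A (term_fact (code_pterm (Num c)) v w)" using assms by (auto simp: certificate_def)
  then show ?case by cases auto
next
  case (Var n)
  then have "justified M A (term_fact (code_pterm (Var n)) v w)" using assms by (auto simp: certificate_def)
  then show ?case by cases (auto simp: env_code_def)
next
  case (Add s t)
  then have "justified M A (term_fact (code_pterm (Add s t)) v w)" using assms by (auto simp: certificate_def)
  then show ?case by cases (auto dest!: Add.IH)
next
  case (Scale c t)
  then have "justified M A (term_fact (code_pterm (Scale c t)) v w)" using assms by (auto simp: certificate_def)
  then show ?case by cases (auto dest!: Scale.IH)
qed

lemma int_encode_le: "int_encode y \<le> 2 * nat \<bar>y\<bar>"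
  by (auto simp: int_encode_def sum_encode_def)

lemma abs_int_decode_le: "\<bar>int_decode x\<bar> \<le> int x"
  by (auto simp: int_decode_def sum_decode_def elim: oddE)

text \<open>Replaces the sum by a number that the program has at hand; it rests on
  \<open>x + y \<le> prod_encode (x, y)\<close>.\<close>

lemma sum_env_code_le: "(\<Sum>i<length (list_decode v). \<bar>env_code v i\<bar>) \<le> int v"
proof -
  have le: "sum_list xs \<le> list_encode xs" for xs
  proof (induction xs)
    case (Cons x xs)
    have "x + y \<le> prod_encode (x, y)" for y
      by (induction y) (simp_all add: prod_encode_def)
    from this[of "list_encode xs"] Cons show ?case by simp
  qed simp
  have "(\<Sum>i<length (list_decode v). \<bar>env_code v i\<bar>) \<le> (\<Sum>i<length (list_decode v). int (list_decode v ! i))"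
    using nth_code_list_encode[of "list_decode v"]
    by (intro sum_mono) (simp add: env_code_def abs_int_decode_le)
  also have "\<dots> = int (sum_list (list_decode v))"
    by (simp add: sum_list_sum_nth atLeast0LessThan)
  also have "\<dots> \<le> int v" using le[of "list_decode v"] by simp
  finally show ?thesis .
qed

lemma bounded_witness_code:
  assumes "0 < n" "form_norm p \<le> n" "rank p \<le> r" "sat (Ex p) (env_code v)"
  shows "\<exists>x<search_range ((sim_step ^^ r) n) v. sat p (env_code (cons_code x v))"
proof -
  let ?M = "(sim_step ^^ r) n" and ?k = "length (list_decode v)"
  have 0: "env_code v i = 0" if "?k \<le> i" for i
    using that nth_code_list_encode[of "list_decode v" i]
    by (simp add: env_code_def int_decode_def sum_decode_def)
  from assms(4) obtain x where "sat p (case_nat x (env_code v))" by auto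
  from sat_bounded_witness[OF assms(1-3) 0 this]
  obtain y where y: "\<bar>y\<bar> \<le> int ?M * ((\<Sum>i<?k. \<bar>env_code v i\<bar>) + 2)"
    and sat: "sat p (case_nat y (env_code v))" by blast
  have "\<bar>y\<bar> \<le> int ?M * (int v + 2)"
    using sum_env_code_le[of v] by (intro order_trans[OF y] mult_left_mono) auto
  then have "nat \<bar>y\<bar> \<le> ?M * (v + 2)"
    by (simp add: nat_le_iff algebra_simps)
  then have "int_encode y < search_range ?M v"
    using int_encode_le[of y] unfolding search_range_def by simp
  then show ?thesis using sat by (intro exI[of _ "int_encode y"]) (simp add: env_code_cons)
qed

text \<open>The bound enters only in the case \<open>Not_Ex\<close>. Subformulas have no larger norm
  or rank, so the same \<open>n\<close> and \<open>r\<close> serve at every quantifier.\<close>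

lemma certificate_form_sound:
  assumes A: "certificate ((sim_step ^^ r) n) A" and n: "0 < n"
  shows "form_fact (code_pform p) v b \<in> A \<Longrightarrow> form_norm p \<le> n \<Longrightarrow> rank p \<le> r \<Longrightarrow>
    b = of_bool (sat p (env_code v))"
proof (induction p arbitrary: v b)
  case (Eq s t)
  then have "justified ((sim_step ^^ r) n) A (form_fact (code_pform (Eq s t)) v b)"
    using A by (auto simp: certificate_def)
  then show ?case by cases (auto dest!: certificate_term_sound[OF A] simp: int_encode_eq)
next
  case (Leq s t)
  then have "justified ((sim_step ^^ r) n) A (form_fact (code_pform (Leq s t)) v b)"
    using A by (auto simp: certificate_def)
  then show ?case by cases (auto dest!: certificate_term_sound[OF A])
next
  case (Neg p)
  then have "justified ((sim_step ^^ r) n) A (form_fact (code_pform (Neg p)) v b)"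
    using A by (auto simp: certificate_def)
  then show ?case
  proof cases
    case (Neg a v' x)
    then have "x = of_bool (sat p (env_code v))" using Neg.prems by (intro Neg.IH) auto
    then show ?thesis using Neg by simp
  qed auto
next
  case (Conj p q)
  then have "justified ((sim_step ^^ r) n) A (form_fact (code_pform (Conj p q)) v b)"
    using A by (auto simp: certificate_def)
  then show ?case
  proof cases
    case (Conj a v' x b' y)
    then have *: "form_fact (code_pform p) v x \<in> A" "form_fact (code_pform q) v y \<in> A" by auto
    have "x = of_bool (sat p (env_code v))" using Conj.prems by (intro Conj.IH(1) *) auto
    moreover have "y = of_bool (sat q (env_code v))" using Conj.prems by (intro Conj.IH(2) *) auto
    ultimately show ?thesis using Conj by simp
  qed auto
next
  case (Ex p)
  then have "justified ((sim_step ^^ r) n) A (form_fact (code_pform (Ex p)) v b)"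
    using A by (auto simp: certificate_def)
  then show ?case
  proof cases
    case (Ex a x v')
    then have "1 = (of_bool (sat p (env_code (cons_code x v))) :: nat)" using Ex.prems by (intro Ex.IH) auto
    then show ?thesis using Ex by (auto simp: env_code_cons split: if_splits)
  next
    case (Not_Ex v' a)
    have "\<not> sat p (env_code (cons_code x v))" if "x < search_range ((sim_step ^^ r) n) v" for x
    proof -
      have "0 = (of_bool (sat p (env_code (cons_code x v))) :: nat)"
        using Ex.prems Not_Ex that by (intro Ex.IH) auto
      then show ?thesis by simp
    qed
    then have "\<not> sat (Ex p) (env_code v)"
      using bounded_witness_code[OF n, of p r v] Ex.prems by auto
    then show ?thesis using Not_Ex by simp
  qed auto
qed

text \<open>Membership in \<open>A\<close> occurs only positively in the rules; this is what allows
  certificates to be merged.\<close>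

lemma justified_mono: "justified M A x \<Longrightarrow> A \<subseteq> B \<Longrightarrow> justified M B x"
  by (induction rule: justified.induct) (blast intro: justified.intros)+

lemma certificate_UN:
  assumes "finite I" "\<And>i. i \<in> I \<Longrightarrow> certificate M (A i)"
  shows "certificate M (\<Union>i\<in>I. A i)"
  using assms unfolding certificate_def by (blast intro: justified_mono)

lemma certificate_Un: "certificate M A \<Longrightarrow> certificate M B \<Longrightarrow> certificate M (A \<union> B)"
  unfolding certificate_def by (blast intro: justified_mono)

lemma certificate_insert: "certificate M A \<Longrightarrow> justified M A x \<Longrightarrow> certificate M (insert x A)"
  unfolding certificate_def by (blast intro: justified_mono)

lemma certificate_term_complete:
  "\<exists>A. certificate M A \<and> term_fact (code_pterm t) v (int_encode (tval (env_code v) t)) \<in> A"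
proof (induction t)
  case (Num c)
  have "certificate M {term_fact (code_pterm (Num c)) v (int_encode (tval (env_code v) (Num c)))}"
    by (simp add: certificate_def justified.Num)
  then show ?case by blast
next
  case (Var n)
  have "certificate M {term_fact (code_pterm (Var n)) v (int_encode (tval (env_code v) (Var n)))}"
    by (simp add: certificate_def env_code_def justified.Var[unfolded One_nat_def])
  then show ?case by blast
next
  case (Add s t)
  then obtain A B where A: "certificate M A" "term_fact (code_pterm s) v (int_encode (tval (env_code v) s)) \<in> A"
    and B: "certificate M B" "term_fact (code_pterm t) v (int_encode (tval (env_code v) t)) \<in> B" by blast
  have "justified M (A \<union> B) (term_fact (code_pterm (Add s t)) v (int_encode (tval (env_code v) (Add s t))))"
    using justified.Add[of _ v _ "A \<union> B", OF UnI1[OF A(2)] UnI2[OF B(2)]] by simp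
  from certificate_insert[OF certificate_Un[OF A(1) B(1)] this] show ?case by blast
next
  case (Scale c t)
  then obtain A where A: "certificate M A" "term_fact (code_pterm t) v (int_encode (tval (env_code v) t)) \<in> A"
    by blast
  have "justified M A (term_fact (code_pterm (Scale c t)) v (int_encode (tval (env_code v) (Scale c t))))"
    using justified.Scale[OF A(2), of M "int_encode c"] by simp
  from certificate_insert[OF A(1) this] show ?case by blast
qed

text \<open>Any \<open>M\<close> will do: a true existential formula may use a witness of any size,
  and a false one fails at every candidate in the range.\<close>

lemma certificate_form_complete:
  "\<exists>A. certificate M A \<and> form_fact (code_pform p) v (of_bool (sat p (env_code v))) \<in> A"
proof (induction p arbitrary: v)
  case (Eq s t)
  obtain A B where A: "certificate M A" "term_fact (code_pterm s) v (int_encode (tval (env_code v) s)) \<in> A"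
    and B: "certificate M B" "term_fact (code_pterm t) v (int_encode (tval (env_code v) t)) \<in> B"
    using certificate_term_complete by blast
  have "justified M (A \<union> B) (form_fact (code_pform (Eq s t)) v (of_bool (sat (Eq s t) (env_code v))))"
    using justified.Eq[of _ v _ "A \<union> B", OF UnI1[OF A(2)] UnI2[OF B(2)]] by (simp add: int_encode_eq)
  from certificate_insert[OF certificate_Un[OF A(1) B(1)] this] show ?case by blast
next
  case (Leq s t)
  obtain A B where A: "certificate M A" "term_fact (code_pterm s) v (int_encode (tval (env_code v) s)) \<in> A"
    and B: "certificate M B" "term_fact (code_pterm t) v (int_encode (tval (env_code v) t)) \<in> B"
    using certificate_term_complete by blast
  have "justified M (A \<union> B) (form_fact (code_pform (Leq s t)) v (of_bool (sat (Leq s t) (env_code v))))"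
    using justified.Leq[of _ v _ "A \<union> B", OF UnI1[OF A(2)] UnI2[OF B(2)]] by simp
  from certificate_insert[OF certificate_Un[OF A(1) B(1)] this] show ?case by blast
next
  case (Neg p)
  then obtain A where A: "certificate M A" "form_fact (code_pform p) v (of_bool (sat p (env_code v))) \<in> A"
    by blast
  have "justified M A (form_fact (code_pform (Neg p)) v (of_bool (sat (Neg p) (env_code v))))"
    using justified.Neg[OF A(2), of M] by (cases "sat p (env_code v)") simp_all
  from certificate_insert[OF A(1) this] show ?case by blast
next
  case (Conj p q)
  then obtain A B where A: "certificate M A" "form_fact (code_pform p) v (of_bool (sat p (env_code v))) \<in> A"
    and B: "certificate M B" "form_fact (code_pform q) v (of_bool (sat q (env_code v))) \<in> B" by blast
  have "justified M (A \<union> B) (form_fact (code_pform (Conj p q)) v (of_bool (sat (Conj p q) (env_code v))))"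
    using justified.Conj[of _ v _ "A \<union> B", OF UnI1[OF A(2)] UnI2[OF B(2)]]
    by (simp only: sat.simps of_bool_conj code_pform.simps)
  from certificate_insert[OF certificate_Un[OF A(1) B(1)] this] show ?case by blast
next
  case (Ex p)
  then obtain A where A: "\<And>v. certificate M (A v)"
    "\<And>v. form_fact (code_pform p) v (of_bool (sat p (env_code v))) \<in> A v" by metis
  show ?case
  proof (cases "sat (Ex p) (env_code v)")
    case True
    then obtain x where "sat p (case_nat x (env_code v))" by auto
    then have "sat p (env_code (cons_code (int_encode x) v))" by (simp add: env_code_cons)
    then have "form_fact (code_pform p) (cons_code (int_encode x) v) 1 \<in> A (cons_code (int_encode x) v)"
      using A(2)[of "cons_code (int_encode x) v"] by simp
    from certificate_insert[OF A(1) justified.Ex[OF this]] True show ?thesis by auto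
  next
    case False
    let ?I = "{..<search_range M v}"
    let ?A = "\<Union>x\<in>?I. A (cons_code x v)"
    have "form_fact (code_pform p) (cons_code x v) 0 \<in> A (cons_code x v)" for x
      using A(2)[of "cons_code x v"] False by (auto simp: env_code_cons)
    then have "\<forall>x<search_range M v. form_fact (code_pform p) (cons_code x v) 0 \<in> ?A" by blast
    from certificate_insert[OF certificate_UN[OF _ A(1)] justified.Not_Ex[OF this]] False
    show ?thesis by auto
  qed
qed

section \<open>Bounds on norm and rank in terms of the code\<close>

lemma add_le_prod_encode: "a + b \<le> prod_encode (a, b)"
  by (induction b) (simp_all add: prod_encode_def)

text \<open>Exponential because \<open>Scale\<close> multiplies norms: exponents add, and two codes
  sum to at most the code of their pair. For \<open>Add\<close>, the extra factor 2 is covered by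
  the tag of the constructor.\<close>

lemma term_norm_le_code: "term_norm t \<le> 2 ^ code_pterm t"
proof (induction t)
  case (Num c)
  have "nat \<bar>c\<bar> \<le> int_encode c" using abs_int_decode_le[of "int_encode c"] by simp
  also have "\<dots> \<le> code_pterm (Num c)" by (simp add: le_prod_encode_2)
  also have "\<dots> \<le> 2 ^ code_pterm (Num c)" by simp
  finally show ?case by simp
next
  case (Add s t)
  let ?a = "code_pterm s" and ?b = "code_pterm t"
  have "(2::nat) ^ ?a \<le> 2 ^ (?a + ?b)" "(2::nat) ^ ?b \<le> 2 ^ (?a + ?b)"
    by (intro power_increasing; simp)+
  then have "term_norm s + term_norm t \<le> 2 ^ (?a + ?b) + 2 ^ (?a + ?b)"
    using Add by linarith
  also have "\<dots> = 2 ^ Suc (?a + ?b)" by simp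
  also have "\<dots> \<le> 2 ^ code_pterm (Add s t)"
    using add_le_prod_encode[of 2 "prod_encode (?a, ?b)"] add_le_prod_encode[of ?a ?b]
    by (intro power_increasing) auto
  finally show ?case by simp
next
  case (Scale c t)
  let ?a = "int_encode c" and ?b = "code_pterm t"
  have "nat \<bar>c\<bar> \<le> ?a" using abs_int_decode_le[of ?a] by simp
  also have "?a \<le> 2 ^ ?a" by simp
  finally have "nat \<bar>c\<bar> * term_norm t \<le> 2 ^ ?a * 2 ^ ?b" using Scale by (rule mult_mono) auto
  also have "\<dots> = 2 ^ (?a + ?b)" by (simp add: power_add)
  also have "\<dots> \<le> 2 ^ code_pterm (Scale c t)"
    using add_le_prod_encode[of 3 "prod_encode (?a, ?b)"] add_le_prod_encode[of ?a ?b]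
    by (intro power_increasing) auto
  finally show ?case by simp
qed simp

lemma norm_add:
  assumes "prod_encode (code_pterm s, code_pterm t) \<le> c"
  shows "term_norm s + term_norm t \<le> 2 ^ Suc c"
proof -
  have "code_pterm s \<le> c" "code_pterm t \<le> c"
    using assms order_trans[OF le_prod_encode_1] order_trans[OF le_prod_encode_2] by blast+
  then have "(2::nat) ^ code_pterm s \<le> 2 ^ c" "(2::nat) ^ code_pterm t \<le> 2 ^ c"
    by (simp_all add: power_increasing)
  then show ?thesis using term_norm_le_code[of s] term_norm_le_code[of t]
    unfolding power_Suc mult_2 by linarith
qed

text \<open>Both parameters of the witness bound can thus be taken from the code alone. For
  \<open>Ex\<close>, the tag makes the code grow along with the rank.\<close>

lemma form_norm_rank_le_code: "form_norm p \<le> 2 ^ Suc (code_pform p) \<and> rank p \<le> code_pform p"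
proof -
  have mono: "x \<le> 2 ^ Suc b" if "x \<le> 2 ^ Suc a" "a \<le> b" for x a b :: nat
    using that power_increasing[of "Suc a" "Suc b" "2::nat"] by linarith
  show ?thesis
  proof (induction p)
    case (Eq s t)
    show ?case using norm_add[of s t "code_pform (Eq s t)"] le_prod_encode_2 by simp
  next
    case (Leq s t)
    show ?case using norm_add[of s t "code_pform (Leq s t)"] le_prod_encode_2 by simp
  next
    case (Neg p)
    have "code_pform p \<le> code_pform (Neg p)" by (simp add: le_prod_encode_2)
    with Neg show ?case using mono[of "form_norm p"] by (auto simp del: power_Suc code_pform.simps intro: order_trans)
  next
    case (Conj p q)
    have "code_pform p \<le> code_pform (Conj p q)" "code_pform q \<le> code_pform (Conj p q)"
      using le_prod_encode_2[of "prod_encode (code_pform p, code_pform q)" 3]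
        le_prod_encode_1[of "code_pform p" "code_pform q"] le_prod_encode_2[of "code_pform q" "code_pform p"]
      by simp_all
    with Conj show ?case using mono[of "form_norm p"] mono[of "form_norm q"]
      by (auto simp del: power_Suc code_pform.simps intro: order_trans)
  next
    case (Ex p)
    have "Suc (code_pform p) \<le> code_pform (Ex p)" using add_le_prod_encode[of 4 "code_pform p"] by simp
    with Ex show ?case using mono[of "form_norm p" "code_pform p" "code_pform (Ex p)"]
      by (simp del: power_Suc code_pform.simps)
  qed

qed

section \<open>Computability of the certificate check\<close>

lemma less_if_mem_set_decode: "x \<in> set_decode t \<Longrightarrow> x < t"
proof (rule ccontr)
  assume "x \<in> set_decode t" "\<not> x < t"
  then have "t < 2 ^ x" using less_exp[of x] by linarith
  then show False using \<open>x \<in> set_decode t\<close> by (simp add: set_decode_def)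
qed

lemma computable_sum_vars: "computable (\<lambda>e. \<Sum>i<n. e i)"
  by (induction n) (auto intro: computable_arith)

lemma prod_encode_leD:
  assumes "prod_encode (a, b) \<le> B"
  shows "a \<le> B \<and> b \<le> B"
  using assms order_trans[OF le_prod_encode_1] order_trans[OF le_prod_encode_2] by blast

lemma fact_leD:
  "term_fact c v w \<le> B \<Longrightarrow> c \<le> B \<and> v \<le> B \<and> w \<le> B"
  "form_fact c v w \<le> B \<Longrightarrow> c \<le> B \<and> v \<le> B \<and> w \<le> B"
  unfolding term_fact_def form_fact_def by (auto dest!: prod_encode_leD)

lemma cons_code_leD: "cons_code x v \<le> B \<Longrightarrow> x \<le> B \<and> v \<le> B"
  unfolding cons_code_def by (auto dest!: prod_encode_leD Suc_leD)

lemma computable_facts: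
  assumes "computable c" "computable v" "computable w"
  shows "computable (\<lambda>e. term_fact (c e) (v e) (w e))" "computable (\<lambda>e. form_fact (c e) (v e) (w e))"
  unfolding term_fact_def form_fact_def by (intro computable_intros assms)+

lemma computable_cons_code: "computable f \<Longrightarrow> computable g \<Longrightarrow> computable (\<lambda>e. cons_code (f e) (g e))"
  unfolding cons_code_def by (intro computable_intros)

lemma computable_search_range: "computable f \<Longrightarrow> computable g \<Longrightarrow> computable (\<lambda>e. search_range (f e) (g e))"
  unfolding search_range_def by (intro computable_intros)

text \<open>The number 12 exceeds the number of variables in scope wherever this rule is applied.\<close>

lemma computable_pred_ex_vars:
  assumes "\<And>e x B. \<forall>k<12. e k \<le> B \<Longrightarrow> P x e \<Longrightarrow> x \<le> B" "computable_pred (\<lambda>e. P (e 0) (\<lambda>i. e (Suc i)))"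
  shows "computable_pred (\<lambda>e. \<exists>x. P x e)"
proof (rule computable_pred_ex[where n = "\<lambda>e. \<Sum>i<12. e i"])
  show "x \<le> (\<Sum>i<12. e i)" if "P x e" for x e
    by (rule assms(1)[of e _ x]) (auto intro: member_le_sum that)
qed (rule computable_sum_vars assms(2))+

text \<open>The premises of \<open>justified\<close> are memberships in \<open>A\<close>, never
  \<open>justified\<close> itself, so unfolding gives a disjunction without recursion. All witnesses
  are components of the fact or of elements of the coded set, hence bounded by variables in
  scope.\<close>

lemma computable_justified_vars: "computable_pred (\<lambda>e. justified (e 0) (set_decode (e 1)) (e 2))"
proof -
  note rules = computable_or computable_pred_ex_vars computable_and computable_eq
    computable_facts computable_cons_code computable_search_range computable_set_decode
    computable_pred_all_less computable_var computable_const computable_prod_encode computable_nth_code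
    computable_int_add computable_int_mult computable_int_le computable_of_bool computable_mult computable_diff
  have fact_memD: "term_fact c v w \<in> set_decode t \<Longrightarrow> c \<le> t \<and> v \<le> t \<and> w \<le> t"
    "form_fact c v w \<in> set_decode t \<Longrightarrow> c \<le> t \<and> v \<le> t \<and> w \<le> t" for t c v w
    using fact_leD[of c v w t] less_imp_le[OF less_if_mem_set_decode] by blast+
  show ?thesis
    unfolding justified.simps
    by (intro rules) (auto simp: All_less_Suc numeral_eq_Suc dest!: fact_leD fact_memD cons_code_leD prod_encode_leD)
qed

lemma computable_justified:
  assumes "computable m" "computable t" "computable z"
  shows "computable_pred (\<lambda>e. justified (m e) (set_decode (t e)) (z e))"
proof -
  have "computable (\<lambda>e. if i = 0 then m e else if i = 1 then t e else z e)" for i :: nat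
    by (cases "i = 0"; cases "i = 1") (simp_all add: assms)
  from computable_subst[OF computable_of_bool[OF computable_justified_vars],
      of "\<lambda>e i. if i = 0 then m e else if i = 1 then t e else z e", OF this] show ?thesis
    by (simp add: computable_pred_def)
qed

lemma computable_sim_step_iterate:
  assumes "computable r" "computable n"
  shows "computable (\<lambda>e. (sim_step ^^ r e) (n e))"
proof -
  have "computable (\<lambda>e. rec_nat (n e) (\<lambda>m y. sim_step y) (r e))"
    unfolding sim_step_def by (intro computable_rec computable_intros assms)
  moreover have "rec_nat a (\<lambda>m y. sim_step y) b = (sim_step ^^ b) a" for a b
    by (induction b) auto
  ultimately show ?thesis by simp
qed

section \<open>Emptiness as a reachability problem on orbits\<close>

text \<open>The modulus is a constant of the formula and \<open>k = 0\<close> a disjunct, so the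
  code is a monotone computable expression in \<open>k\<close>.\<close>

definition zmod_form :: "nat \<Rightarrow> nat \<Rightarrow> pform" where
  "zmod_form k i = Neg (Conj (Neg (Eq (Num (int k)) (Num 0)))
     (Neg (Conj (Leq (Num 0) (Var i)) (Neg (Leq (Num (int k)) (Var i))))))"

text \<open>The innermost quantifier binds the source, so \<open>p\<close> sees the triple in the
  right order without substitution.\<close>

definition edge_form :: "nat \<Rightarrow> nat \<Rightarrow> nat \<Rightarrow> pform \<Rightarrow> pform" where
  "edge_form k l m p =
     Ex (Ex (Ex (Conj p (Conj (zmod_form k 0) (Conj (zmod_form l 1) (zmod_form m 2))))))"

lemma sat_zmod_form: "sat (zmod_form k i) e \<longleftrightarrow> e i \<in> Zmod k"
proof (cases "k = 0")
  case False
  then have "0 \<le> e i mod int k" "e i mod int k < int k" by simp_all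
  with False show ?thesis by (auto simp: zmod_form_def Zmod_def)
qed (simp add: zmod_form_def Zmod_def)

lemma sat_edge_form:
  "sat (edge_form k l m p) (\<lambda>_. 0) \<longleftrightarrow>
     (\<exists>x\<in>Zmod k. \<exists>y\<in>Zmod l. \<exists>z\<in>Zmod m. sat p (valuation [x, y, z]))"
proof -
  have "case_nat x (case_nat y (case_nat z (\<lambda>_. 0))) = valuation [x, y, z]" for x y z
    by (auto simp: valuation_def fun_eq_iff nth_Cons split: nat.split)
  moreover have "valuation [x, y, z] 0 = x" "valuation [x, y, z] 1 = y" "valuation [x, y, z] 2 = z" for x y z
    by (simp_all add: valuation_def)
  ultimately show ?thesis unfolding edge_form_def sat.simps sat_zmod_form by auto
qed

definition orbit_edge :: "description \<Rightarrow> nat \<Rightarrow> nat \<Rightarrow> bool" where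
  "orbit_edge D i j \<longleftrightarrow> (\<exists>a p. (i, a, j, p) \<in> set (trans_forms D) \<and>
     i < length (state_chars D) \<and> a < length (letter_chars D) \<and> j < length (state_chars D) \<and>
     sat (edge_form (state_chars D ! i) (letter_chars D ! a) (state_chars D ! j) p) (\<lambda>_. 0))"

lemma orbit_edge_iff:
  "orbit_edge D i j \<longleftrightarrow> (\<exists>x a y z. ((i, x), (a, y), (j, z)) \<in> transitions (nfa_of D))"
  unfolding orbit_edge_def sat_edge_form by (auto simp: nfa_of_def orbit_sum_def) blast+

lemma run_append:
  "run M q v q' \<Longrightarrow> (q', a, q'') \<in> transitions M \<Longrightarrow> run M q (v @ [a]) q''"
  by (induction rule: run.induct) (auto intro: run.intros)

text \<open>Here equivariance enters: translation by \<open>x' - x\<close> moves the source to any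
  state of its orbit and takes letter and target along.\<close>

lemma transition_translate:
  assumes eqv: "equivariant_nfa (nfa_of D)" and t: "((i, x), (a, y), (j, z)) \<in> transitions (nfa_of D)"
    and x': "(i, x') \<in> orbit_sum (state_chars D)"
  shows "\<exists>y' z'. ((i, x'), (a, y'), (j, z')) \<in> transitions (nfa_of D)"
proof -
  have mem: "(i, x) \<in> orbit_sum (state_chars D)" "(a, y) \<in> orbit_sum (letter_chars D)"
    "(j, z) \<in> orbit_sum (state_chars D)" using t by (auto simp: nfa_of_def)
  have "trans_act (nfa_of D) (x' - x) ((i, x), (a, y), (j, z)) \<in> transitions (nfa_of D)"
    using eqv imageI[OF t, of "trans_act (nfa_of D) (x' - x)"]
    by (simp only: equivariant_nfa_def equivariant_subset_def)
  moreover have "shift (state_chars D) (x' - x) (i, x) = (i, x')"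
    using mem x' by (simp add: shift_def orbit_sum_def Zmod_def)
  ultimately show ?thesis
    using mem by (auto simp: trans_act_def shift_def nfa_of_def)
qed

text \<open>A separating closed set replaces the search for paths: it is a finite object over which
  the program can quantify. The length tests discard listed orbit numbers that are out of
  range.\<close>

lemma language_empty_iff:
  assumes eqv: "equivariant_nfa (nfa_of D)"
  shows "language (nfa_of D) = {} \<longleftrightarrow>
    (\<exists>S\<subseteq>{..<length (state_chars D)}.
       (\<forall>i\<in>set (init_orbits D). i < length (state_chars D) \<longrightarrow> i \<in> S) \<and>
       (\<forall>i j. orbit_edge D i j \<longrightarrow> i \<in> S \<longrightarrow> j \<in> S) \<and>
       (\<forall>i\<in>set (acc_orbits D). i < length (state_chars D) \<longrightarrow> i \<notin> S))"
  (is "_ \<longleftrightarrow> (\<exists>S\<subseteq>?I. ?init S \<and> ?closed S \<and> ?acc S)")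
proof
  let ?M = "nfa_of D"
  have sum: "states ?M = orbit_sum (state_chars D)" "letters ?M = orbit_sum (letter_chars D)"
    and ini: "initial ?M = {(i, x) \<in> orbit_sum (state_chars D). i \<in> set (init_orbits D)}"
    and acc: "accepting ?M = {(i, x) \<in> orbit_sum (state_chars D). i \<in> set (acc_orbits D)}"
    by (simp_all add: nfa_of_def)
  have tr: "transitions ?M \<subseteq> states ?M \<times> letters ?M \<times> states ?M"
    using nfa_with_atoms_nfa_of by (simp add: nfa_with_atoms_def)
  {
    assume empty: "language ?M = {}"
    define S where "S = {i \<in> ?I. \<exists>q\<in>initial ?M. \<exists>w\<in>lists (letters ?M). \<exists>x\<in>Zmod (state_chars D ! i). run ?M q w (i, x)}"
    have "?init S"
    proof (intro ballI impI)
      fix i assume i: "i \<in> set (init_orbits D)" "i < length (state_chars D)"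
      then have "(i, 0) \<in> initial ?M" by (simp add: ini orbit_sum_def Zmod_def)
      moreover have "run ?M (i, 0) [] (i, 0)" by (rule run.intros)
      moreover have "[] \<in> lists (letters ?M)" "0 \<in> Zmod (state_chars D ! i)" by (simp_all add: Zmod_def)
      ultimately show "i \<in> S" using i unfolding S_def by blast
    qed
    moreover have "?closed S"
    proof (intro allI impI)
      fix i j assume edge: "orbit_edge D i j" and "i \<in> S"
      then obtain q w x where q: "q \<in> initial ?M" "w \<in> lists (letters ?M)" "run ?M q w (i, x)"
        and x: "(i, x) \<in> orbit_sum (state_chars D)"
        unfolding S_def by (auto simp: orbit_sum_def)
      \<comment> \<open>The edge may start elsewhere in orbit \<open>i\<close>; translation makes it
        start at the reached state.\<close>
      from edge obtain a y z where t: "((i, x), (a, y), (j, z)) \<in> transitions ?M"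
        using transition_translate[OF eqv _ x] unfolding orbit_edge_iff by blast
      with tr have letter: "(a, y) \<in> letters ?M" and "j \<in> ?I" "z \<in> Zmod (state_chars D ! j)"
        by (auto simp: sum(1) orbit_sum_def)
      moreover have "run ?M q (w @ [(a, y)]) (j, z)" using run_append[OF q(3) t] .
      moreover from letter q(2) have "w @ [(a, y)] \<in> lists (letters ?M)" by simp
      ultimately show "j \<in> S" using q(1) unfolding S_def by blast
    qed
    moreover have "?acc S"
    proof (intro ballI impI notI)
      fix i assume i: "i \<in> set (acc_orbits D)" "i < length (state_chars D)" "i \<in> S"
      then obtain q w x where q: "q \<in> initial ?M" "w \<in> lists (letters ?M)" "run ?M q w (i, x)"
        and "x \<in> Zmod (state_chars D ! i)" unfolding S_def by blast
      with i have "(i, x) \<in> accepting ?M" by (simp add: acc orbit_sum_def)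
      with q empty show False unfolding language_def by blast
    qed
    moreover have "S \<subseteq> ?I" by (auto simp: S_def)
    ultimately show "\<exists>S\<subseteq>?I. ?init S \<and> ?closed S \<and> ?acc S" by blast
  }
  {
    assume "\<exists>S\<subseteq>?I. ?init S \<and> ?closed S \<and> ?acc S"
    then obtain S where S: "?init S" "?closed S" "?acc S" by blast
    have "fst q' \<in> S" if "run ?M q w q'" "fst q \<in> S" for q w q'
      using that
    proof induction
      case (2 q a q' w q'')
      have "orbit_edge D (fst q) (fst q')"
        unfolding orbit_edge_iff using 2(1) by (metis prod.collapse)
      then show ?case using 2 S(2) by blast
    qed
    then show "language ?M = {}"
      using S(1,3) by (fastforce simp: language_def ini acc orbit_sum_def)
  }
qed

section \<open>The decision procedure\<close>

text \<open>A function of the code of \<open>p\<close>, and total, so the program never decodes a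
  formula.\<close>

definition edge_code :: "nat \<Rightarrow> nat \<Rightarrow> nat \<Rightarrow> nat \<Rightarrow> nat" where
  "edge_code k l m c = prod_encode (4, prod_encode (4, prod_encode (4, prod_encode (3,
     prod_encode (c, prod_encode (3, prod_encode (code_pform (zmod_form k 0),
       prod_encode (3, prod_encode (code_pform (zmod_form l 1), code_pform (zmod_form m 2))))))))))"

lemma edge_code: "edge_code k l m (code_pform p) = code_pform (edge_form k l m p)"
  by (simp add: edge_code_def edge_form_def)

lemma int_encode_of_nat: "int_encode (int n) = 2 * n"
  by (simp add: int_encode_def sum_encode_def)

lemma prod_encode_mono: "a \<le> c \<Longrightarrow> b \<le> d \<Longrightarrow> prod_encode (a, b) \<le> prod_encode (c, d)"
proof -
  assume *: "a \<le> c" "b \<le> d"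
  then have "(a + b) * Suc (a + b) \<le> (c + d) * Suc (c + d)" by (intro mult_le_mono) auto
  then show ?thesis using * by (simp add: prod_encode_def triangle_def div_le_mono add_le_mono)
qed

lemma edge_code_mono:
  "k \<le> k' \<Longrightarrow> l \<le> l' \<Longrightarrow> m \<le> m' \<Longrightarrow> c \<le> c' \<Longrightarrow> edge_code k l m c \<le> edge_code k' l' m' c'"
  unfolding edge_code_def zmod_form_def code_pform.simps code_pterm.simps int_encode_of_nat
  by (intro prod_encode_mono order_refl mult_le_mono)

lemma computable_edge_code:
  assumes "computable k" "computable l" "computable m" "computable c"
  shows "computable (\<lambda>e. edge_code (k e) (l e) (m e) (c e))"
  unfolding edge_code_def zmod_form_def code_pform.simps code_pterm.simps int_encode_of_nat
  by (intro computable_intros assms)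

definition state_char :: "nat \<Rightarrow> nat \<Rightarrow> nat" where
  "state_char N i = nth_code (nth_code N 0) i"

definition letter_char :: "nat \<Rightarrow> nat \<Rightarrow> nat" where
  "letter_char N i = nth_code (nth_code N 1) i"

definition is_index :: "nat \<Rightarrow> nat \<Rightarrow> bool" where
  "is_index v i \<longleftrightarrow> drop_code i v \<noteq> 0"

definition entry :: "nat \<Rightarrow> nat \<Rightarrow> nat \<Rightarrow> nat" where
  "entry N q c = nth_code (nth_code (nth_code N 4) q) c"

definition entry_code :: "nat \<Rightarrow> nat \<Rightarrow> nat" where
  "entry_code N q = edge_code (state_char N (entry N q 0)) (letter_char N (entry N q 1))
     (state_char N (entry N q 2)) (entry N q 3)"

text \<open>All numbers extracted from \<open>N\<close> are at most \<open>N\<close> and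
  \<open>edge_code\<close> is monotone, so this bounds every \<open>entry_code\<close>.\<close>

definition code_bound :: "nat \<Rightarrow> nat" where
  "code_bound N = edge_code N N N N"

text \<open>The rank is at most the code and the norm at most \<open>2 ^ Suc\<close> of it, as in
  \<open>form_norm_rank_le_code\<close>.\<close>

definition witness_bound :: "nat \<Rightarrow> nat" where
  "witness_bound N = (sim_step ^^ code_bound N) (2 ^ Suc (code_bound N))"

text \<open>A verdict is demanded for every entry, so that a missing positive verdict means falsity.
  The bounds \<open>t\<close> and \<open>N\<close> lose nothing: elements of a coded set are below
  its code, and lengths of lists are at most theirs.\<close>

definition decides_edges :: "nat \<Rightarrow> nat \<Rightarrow> bool" where
  "decides_edges t N \<longleftrightarrow>
     (\<forall>x<t. x \<in> set_decode t \<longrightarrow> justified (witness_bound N) (set_decode t) x) \<and>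
     (\<forall>q<N. is_index (nth_code N 4) q \<longrightarrow>
       form_fact (entry_code N q) 0 0 \<in> set_decode t \<or> form_fact (entry_code N q) 0 1 \<in> set_decode t)"

text \<open>There are at most \<open>N\<close> orbits of states, so all sets of them have codes
  below \<open>2 ^ N\<close>.\<close>

definition unreachable :: "nat \<Rightarrow> nat \<Rightarrow> bool" where
  "unreachable t N \<longleftrightarrow> (\<exists>S<2 ^ N.
     (\<forall>q<N. is_index (nth_code N 2) q \<and> is_index (nth_code N 0) (nth_code (nth_code N 2) q) \<longrightarrow>
       nth_code (nth_code N 2) q \<in> set_decode S) \<and>
     (\<forall>q<N. is_index (nth_code N 4) q \<and> is_index (nth_code N 0) (entry N q 0) \<and>
       is_index (nth_code N 1) (entry N q 1) \<and> is_index (nth_code N 0) (entry N q 2) \<and>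
       form_fact (entry_code N q) 0 1 \<in> set_decode t \<and> entry N q 0 \<in> set_decode S \<longrightarrow>
       entry N q 2 \<in> set_decode S) \<and>
     (\<forall>q<N. is_index (nth_code N 3) q \<and> is_index (nth_code N 0) (nth_code (nth_code N 3) q) \<longrightarrow>
       nth_code (nth_code N 3) q \<notin> set_decode S))"

lemma computable_decides_edges: "computable_pred (\<lambda>e. decides_edges (e 0) (e 1))"
  unfolding decides_edges_def is_index_def witness_bound_def code_bound_def entry_code_def entry_def
    state_char_def letter_char_def
  by (intro computable_intros computable_justified computable_facts computable_sim_step_iterate
      computable_edge_code)

lemma computable_unreachable: "computable_pred (\<lambda>e. unreachable (e 0) (e 1))"
  unfolding unreachable_def is_index_def entry_code_def entry_def state_char_def letter_char_def
  by (intro computable_intros computable_facts computable_edge_code)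

section \<open>Correctness on the code of a description\<close>

context
  fixes D :: description and N :: nat
  defines "N \<equiv> code_description D"
begin

lemma fields:
  "nth_code N 0 = list_encode (state_chars D)" "nth_code N 1 = list_encode (letter_chars D)"
  "nth_code N 2 = list_encode (init_orbits D)" "nth_code N 3 = list_encode (acc_orbits D)"
  "nth_code N 4 = list_encode (map code_entry (trans_forms D))"
  unfolding N_def code_description_def nth_code_list_encode by (simp_all del: list_encode.simps)

lemma is_index_list_encode: "is_index (list_encode xs) i \<longleftrightarrow> i < length xs"
  by (simp add: is_index_def drop_code_eq_0 not_le)

lemma index_less: "nth_code N c = list_encode xs \<Longrightarrow> q < length xs \<Longrightarrow> q < N"
  using nth_code_le[of N c] length_le_list_encode[of xs] by linarith

lemma entry_eq:
  assumes "q < length (trans_forms D)" "trans_forms D ! q = (i, a, j, p)"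
  shows "entry N q 0 = i" "entry N q 1 = a" "entry N q 2 = j" "entry N q 3 = code_pform p"
  using assms unfolding entry_def fields
  by (simp_all add: nth_code_list_encode code_entry_def del: list_encode.simps)

text \<open>Stated with \<open>state_char\<close> and \<open>letter_char\<close>, which return 0 for
  indices out of range; such entries receive verdicts as well.\<close>

lemma entry_code_eq:
  assumes "q < length (trans_forms D)" "trans_forms D ! q = (i, a, j, p)"
  shows "entry_code N q = code_pform (edge_form (state_char N i) (letter_char N a) (state_char N j) p)"
  unfolding entry_code_def entry_eq[OF assms] edge_code ..

lemma entry_code_le: "entry_code N q \<le> code_bound N"
proof -
  have 1: "nth_code (nth_code N c) i \<le> N" for c i by (rule order_trans[OF nth_code_le nth_code_le])
  have 2: "nth_code (nth_code (nth_code N c) i) b \<le> N" for c i b by (rule order_trans[OF nth_code_le 1])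
  show ?thesis
    unfolding entry_code_def code_bound_def state_char_def letter_char_def entry_def
    by (intro edge_code_mono 1 2)
qed

lemma decides_edges_sound:
  assumes t: "decides_edges t N" and q: "q < length (trans_forms D)" "trans_forms D ! q = (i, a, j, p)"
  shows "form_fact (entry_code N q) 0 1 \<in> set_decode t \<longleftrightarrow>
    sat (edge_form (state_char N i) (letter_char N a) (state_char N j) p) (\<lambda>_. 0)"
proof -
  let ?F = "edge_form (state_char N i) (letter_char N a) (state_char N j) p"
  have "certificate (witness_bound N) (set_decode t)"
    using t less_if_mem_set_decode unfolding decides_edges_def certificate_def by auto
  moreover have "code_pform ?F \<le> code_bound N"
    using entry_code_le[of q] unfolding entry_code_eq[OF q] .
  then have "form_norm ?F \<le> 2 ^ Suc (code_bound N)" "rank ?F \<le> code_bound N"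
    using form_norm_rank_le_code[of ?F] power_increasing[of "Suc (code_pform ?F)" "Suc (code_bound N)" "2::nat"]
    by linarith+
  ultimately have sound: "b = of_bool (sat ?F (env_code 0))"
    if "form_fact (code_pform ?F) 0 b \<in> set_decode t" for b
    using that certificate_form_sound[of "code_bound N" "2 ^ Suc (code_bound N)"]
    unfolding witness_bound_def by simp
  have "is_index (nth_code N 4) q" "q < N"
    using q(1) index_less[OF fields(5)] by (simp_all add: fields(5) is_index_list_encode)
  then have "form_fact (code_pform ?F) 0 0 \<in> set_decode t \<or> form_fact (code_pform ?F) 0 1 \<in> set_decode t"
    using t entry_code_eq[OF q] unfolding decides_edges_def by metis
  moreover have "\<not> sat ?F (\<lambda>_. 0)" if "form_fact (code_pform ?F) 0 0 \<in> set_decode t"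
    using sound[OF that] by (simp add: env_code_0)
  moreover have "sat ?F (\<lambda>_. 0)" if "form_fact (code_pform ?F) 0 1 \<in> set_decode t"
    using sound[OF that] by (simp add: env_code_0 of_bool_def split: if_splits)
  ultimately show ?thesis unfolding entry_code_eq[OF q] by blast
qed

text \<open>Guarantees that the search halts: one certificate for each entry, merged and coded as a
  number.\<close>

lemma decides_edges_exists: "\<exists>t. decides_edges t N"
proof -
  let ?I = "{..<length (trans_forms D)}"
  have "\<exists>A. certificate (witness_bound N) A \<and>
      (form_fact (entry_code N q) 0 0 \<in> A \<or> form_fact (entry_code N q) 0 1 \<in> A)" if "q \<in> ?I" for q
  proof -
    obtain i a j p where q: "trans_forms D ! q = (i, a, j, p)" by (metis prod.collapse)
    let ?F = "edge_form (state_char N i) (letter_char N a) (state_char N j) p"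
    from that have q': "q < length (trans_forms D)" by simp
    from certificate_form_complete[of "witness_bound N" ?F 0] show ?thesis
      unfolding entry_code_eq[OF q' q] by (auto simp: of_bool_def split: if_splits)
  qed
  then obtain A where A: "\<And>q. q \<in> ?I \<Longrightarrow> certificate (witness_bound N) (A q)"
    "\<And>q. q \<in> ?I \<Longrightarrow> form_fact (entry_code N q) 0 0 \<in> A q \<or> form_fact (entry_code N q) 0 1 \<in> A q" by metis
  define U where "U = (\<Union>q\<in>?I. A q)"
  have cert: "certificate (witness_bound N) U" unfolding U_def using A(1) by (intro certificate_UN) auto
  have "form_fact (entry_code N q) 0 0 \<in> U \<or> form_fact (entry_code N q) 0 1 \<in> U"
    if "is_index (nth_code N 4) q" for q
  proof -
    from that have "q \<in> ?I" by (simp add: fields(5) is_index_list_encode)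
    then show ?thesis using A(2) unfolding U_def by blast
  qed
  then have "decides_edges (set_encode U) N"
    using cert by (simp add: decides_edges_def certificate_def)
  then show ?thesis by blast
qed

lemma all_index_iff:
  assumes "nth_code N c = list_encode xs"
  shows "(\<forall>q<N. is_index (nth_code N c) q \<and> P (nth_code (nth_code N c) q) \<longrightarrow> Q (nth_code (nth_code N c) q))
    \<longleftrightarrow> (\<forall>x\<in>set xs. P x \<longrightarrow> Q x)"
  using index_less[OF assms] unfolding assms is_index_list_encode
  by (auto simp: all_set_conv_all_nth nth_code_list_encode)

lemma set_encode_less: "S \<subseteq> {..<n} \<Longrightarrow> set_encode S < 2 ^ n"
proof -
  assume "S \<subseteq> {..<n}"
  then have "set_encode S \<le> (\<Sum>i<n. 2 ^ i)" unfolding set_encode_def by (intro sum_mono2) auto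
  also have "\<dots> < (2 :: nat) ^ n" by (induction n) auto
  finally show ?thesis .
qed

lemma unreachable_iff:
  assumes t: "decides_edges t N" and eqv: "equivariant_nfa (nfa_of D)"
  shows "unreachable t N \<longleftrightarrow> language (nfa_of D) = {}"
proof -
  let ?I = "{..<length (state_chars D)}"
  have edges: "(\<forall>q<N. is_index (nth_code N 4) q \<and> is_index (nth_code N 0) (entry N q 0) \<and>
       is_index (nth_code N 1) (entry N q 1) \<and> is_index (nth_code N 0) (entry N q 2) \<and>
       form_fact (entry_code N q) 0 1 \<in> set_decode t \<and> entry N q 0 \<in> S \<longrightarrow> entry N q 2 \<in> S)
    \<longleftrightarrow> (\<forall>i j. orbit_edge D i j \<longrightarrow> i \<in> S \<longrightarrow> j \<in> S)" (is "?l \<longleftrightarrow> ?r") for S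
  proof -
    have char: "state_char N i = state_chars D ! i" if "i < length (state_chars D)" for i
      using that by (simp add: state_char_def fields nth_code_list_encode)
    have char': "letter_char N i = letter_chars D ! i" if "i < length (letter_chars D)" for i
      using that unfolding letter_char_def fields by (simp add: nth_code_list_encode)
    show ?thesis
    proof
      assume l: ?l
      show ?r
      proof (intro allI impI)
        fix i j assume "orbit_edge D i j" "i \<in> S"
        then obtain a p where e: "(i, a, j, p) \<in> set (trans_forms D)" and *: "i < length (state_chars D)"
          "a < length (letter_chars D)" "j < length (state_chars D)"
          and sat: "sat (edge_form (state_chars D ! i) (letter_chars D ! a) (state_chars D ! j) p) (\<lambda>_. 0)"
          unfolding orbit_edge_def by blast
        from e obtain q where q: "q < length (trans_forms D)" "trans_forms D ! q = (i, a, j, p)"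
          by (auto simp: in_set_conv_nth)
        have "form_fact (entry_code N q) 0 1 \<in> set_decode t"
          unfolding decides_edges_sound[OF t q] using * sat by (simp add: char char')
        moreover have "q < N" using q(1) index_less[OF fields(5)] by simp
        ultimately show "j \<in> S"
          using l[rule_format, of q] * q(1) \<open>i \<in> S\<close>
          unfolding fields is_index_list_encode entry_eq[OF q] by simp
      qed
    next
      assume r: ?r
      show ?l
      proof (intro allI impI)
        fix q assume "q < N" and h: "is_index (nth_code N 4) q \<and> is_index (nth_code N 0) (entry N q 0) \<and>
          is_index (nth_code N 1) (entry N q 1) \<and> is_index (nth_code N 0) (entry N q 2) \<and>
          form_fact (entry_code N q) 0 1 \<in> set_decode t \<and> entry N q 0 \<in> S"
        then have q: "q < length (trans_forms D)" by (simp add: fields(5) is_index_list_encode)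
        obtain i a j p where e: "trans_forms D ! q = (i, a, j, p)" by (metis prod.collapse)
        have *: "i < length (state_chars D)" "a < length (letter_chars D)" "j < length (state_chars D)" "i \<in> S"
          using h unfolding fields is_index_list_encode entry_eq[OF q e] by simp_all
        have "sat (edge_form (state_char N i) (letter_char N a) (state_char N j) p) (\<lambda>_. 0)"
          using h decides_edges_sound[OF t q e] by simp
        then have "orbit_edge D i j"
          unfolding orbit_edge_def using * q e nth_mem[OF q] by (auto simp: char char')
        then show "entry N q 2 \<in> S" using r * unfolding entry_eq[OF q e] by blast
      qed
    qed
  qed
  have "unreachable t N \<longleftrightarrow> (\<exists>S<2 ^ N.
     (\<forall>i\<in>set (init_orbits D). i < length (state_chars D) \<longrightarrow> i \<in> set_decode S) \<and>
     (\<forall>i j. orbit_edge D i j \<longrightarrow> i \<in> set_decode S \<longrightarrow> j \<in> set_decode S) \<and>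
     (\<forall>i\<in>set (acc_orbits D). i < length (state_chars D) \<longrightarrow> i \<notin> set_decode S))"
    unfolding unreachable_def edges all_index_iff[OF fields(3), of "is_index (nth_code N 0)" "\<lambda>i. i \<in> set_decode _"]
      all_index_iff[OF fields(4), of "is_index (nth_code N 0)" "\<lambda>i. i \<notin> set_decode _"]
    unfolding fields(1) is_index_list_encode ..
  also have "\<dots> \<longleftrightarrow> (\<exists>S\<subseteq>?I.
     (\<forall>i\<in>set (init_orbits D). i < length (state_chars D) \<longrightarrow> i \<in> S) \<and>
     (\<forall>i j. orbit_edge D i j \<longrightarrow> i \<in> S \<longrightarrow> j \<in> S) \<and>
     (\<forall>i\<in>set (acc_orbits D). i < length (state_chars D) \<longrightarrow> i \<notin> S))" (is "(\<exists>S<2 ^ N. ?P (set_decode S)) \<longleftrightarrow> (\<exists>S\<subseteq>?I. ?P S)")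
  proof
    assume "\<exists>S<2 ^ N. ?P (set_decode S)"
    then obtain S where "?P (set_decode S)" by blast
    \<comment> \<open>Restriction keeps the set closed because edges join only orbits within
      range.\<close>
    then have "?P (set_decode S \<inter> ?I)" by (auto simp: orbit_edge_def)
    then show "\<exists>S\<subseteq>?I. ?P S" by - (rule exI, rule conjI[OF Int_lower2])
  next
    assume "\<exists>S\<subseteq>?I. ?P S"
    then obtain S where S: "S \<subseteq> ?I" "?P S" by blast
    have "S \<subseteq> {..<N}" using S(1) index_less[OF fields(1)] by auto
    then have "set_encode S < 2 ^ N" by (rule set_encode_less)
    moreover have "set_decode (set_encode S) = S" using S(1) by (intro set_encode_inverse) (rule finite_subset, auto)
    then have "?P (set_decode (set_encode S))" using S(2) by (simp only:)
    ultimately show "\<exists>S<2 ^ N. ?P (set_decode S)" by - (rule exI, rule conjI)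
  qed
  finally show ?thesis unfolding language_empty_iff[OF eqv] .
qed

end

theorem theorem2:
  shows "decidable code_description
           {D. nfa_with_atoms (nfa_of D) \<and> equivariant_nfa (nfa_of D) \<and> semilinear_nfa (nfa_of D)}
           (\<lambda>D. language (nfa_of D) = {})"
proof -
  \<comment> \<open>The least solution has no special role: \<open>unreachable_iff\<close> holds for
    every \<open>t\<close> that decides the edges.\<close>
  obtain f where f: "\<And>N. \<exists>t. decides_edges t N \<Longrightarrow>
      computes f [N] (of_bool (unreachable (LEAST t. decides_edges t N) N))"
    using computable_search[OF computable_decides_edges computable_of_bool[OF computable_unreachable]] by blast
  have "computes f [code_description D] (if language (nfa_of D) = {} then 1 else 0)"
    if "equivariant_nfa (nfa_of D)" for D
    using f[OF decides_edges_exists[of D]] unreachable_iff[OF LeastI_ex[OF decides_edges_exists] that]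
    by (simp add: of_bool_def)
  then show ?thesis unfolding decidable_def by blast
qed

end
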